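(* Let $z$ be a point of $\mathbb{P}^1(\mathbb{C})\setminus\{0,1,\infty\}$. Given a path $\gamma\in\pi_1^{\rm top}(\mathbb{P}^1(\mathbb{C})\setminus\{0,1,\infty\};\overrightarrow{01},z)$, define $$\gamma':=\delta\cdot\phi(\gamma)\in\pi_1^{\rm top}\left(\mathbb{P}^1(\mathbb{C})\setminus\{0,1,\infty\};\overrightarrow{01},\tfrac{z}{z-1}\right),$$ where $\delta\in\pi_1^{\rm top}(\mathbb{P}^1(\mathbb{C})\setminus\{0,1,\infty\};\overrightarrow{01},\overrightarrow{0\infty})$ is the path from $\overrightarrow{01}$ to $\overrightarrow{0\infty}$ through the upper half plane, $\phi\in{\rm Aut}(\mathbb{P}^1(\mathbb{C})\setminus\{0,1,\infty\})$ is $\phi(z)=\frac{z}{z-1}$, and paths are composed from left to right. Then for every multi-index $\mathbf{k}\in\bigcup_{d=1}^\infty\mathbb{N}^d$, $$Li_{\mathbf{k}}\left(\frac{z}{z-1};\gamma'\right)+(-1)^{1+\mathrm{dp}(\mathbf{k})}\sum_{\mathbf{J}\succeq\mathbf{k}}Li_{\mathbf{J}}(z;\gamma)=0 .$$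
   Context: Here $\mathbb{N}=\{1,2,3,\dots\}$. A multi-index is an element $\mathbf{k}=(k_1,\dots,k_d)$ of $\bigcup_{d\ge1}\mathbb{N}^d$, and $\mathrm{dp}(\mathbf{k}):=d$. Refinement: for $\mathbf{k}=(k_1,\dots,k_d)$ and $\mathbf{J}=(j_1,\dots,j_l)$, write $\mathbf{J}\succeq\mathbf{k}$ if there is $(m_1,\dots,m_d)\in\mathbb{N}^d$ with $\sum_{i=1}^d m_i=l$ such that, with $S_0:=0$ and $S_i:=\sum_{r=1}^i m_r$, one has $k_i=\sum_{q=1}^{m_i}j_{S_{i-1}+q}$ for all $i=1,\dots,d$. Paths: $\overrightarrow{01}$ is the tangential base point at $0$ pointing toward $1$ (along the positive real axis), and $\overrightarrow{0\infty}$ is the tangential base point at $0$ pointing toward $\infty$ along the negative real axis. $\pi_1^{\rm top}(\mathbb{P}^1(\mathbb{C})\setminus\{0,1,\infty\};x,y)$ is the set of homotopy classes of piecewise smooth paths from $x$ to $y$ on $\mathbb{P}^1(\mathbb{C})\setminus\{0,1,\infty\}$; $\gamma_1\cdot\gamma_2$ means first $\gamma_1$, then $\gamma_2$. The path $\delta$ is a counterclockwise half-turn around $0$ (near $0$) in the upper half plane. The map $\phi$ sends $\overrightarrow{01}$ to $\overrightarrow{0\infty}$, so $\phi(\gamma)$ is a path from $\overrightarrow{0\infty}$ to $\frac{z}{z-1}$. Complex multiple polylogarithms: for $\gamma\in\pi_1^{\rm top}(\mathbb{P}^1(\mathbb{C})\setminus\{0,1,\infty\};\overrightarrow{01},z)$,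 the number $Li_{\mathbf{k}}(z;\gamma)\in\mathbb{C}$ is defined recursively by iterated integration along $\gamma$ (inside the integral, $Li(t;\gamma)$ denotes the value at the point $t$ of $\gamma$, computed along the part of $\gamma$ from $\overrightarrow{01}$ to $t$): $$Li_1(z;\gamma):=\int_\gamma\frac{dt}{1-t},\qquad Li_{k_1,\dots,k_d}(z;\gamma):=\begin{cases}\displaystyle\int_\gamma\frac1t\,Li_{k_1,\dots,k_{d-1},k_d-1}(t;\gamma)\,dt & (k_d\ne1),\\[2mm] \displaystyle\int_\gamma\frac{1}{1-t}\,Li_{k_1,\dots,k_{d-1}}(t;\gamma)\,dt & (k_d=1,\ d\ge 2).\end{cases}$$ *)

theory Defs
  imports "HOL-Analysis.Analysis"
begin

(* As a set, P^1(C) - {0,1,infinity} is the complex plane without 0 and 1. *)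
abbreviation thrice_punctured :: "complex set"
  where "thrice_punctured \<equiv> - {0, 1}"

(* "Pt a" is an ordinary point a; "Tangential a v" is the tangential base point at the
   puncture a in the direction of the unit vector v. *)
datatype base_point = Pt complex | Tangential complex complex

(* A path leaves a tangential base point (a, v) if it starts at a and its direction as seen from a
   tends to v, that is, if it starts at the boundary point v of the real oriented blow-up at a.
   For a family of paths (a homotopy, with parameter s) this has to hold uniformly in s;
   otherwise a small loop around the puncture could be contracted into it. *)
fun departs :: "base_point \<Rightarrow> (real \<Rightarrow> real \<Rightarrow> complex) \<Rightarrow> bool" where
  "departs (Pt a) H \<longleftrightarrow> (\<forall>s\<in>{0..1}. H s 0 = a)"
| "departs (Tangential a v) H \<longleftrightarrow> (\<forall>s\<in>{0..1}. H s 0 = a) \<and>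
     uniform_limit {0..1} (\<lambda>t s. sgn (H s t - a)) (\<lambda>_. v) (at_right 0)"

(* A path ends at y if the reversed path starts at y. So a path ending at a tangential base
   point (a, v) approaches a from the side to which v points. *)
definition joins :: "base_point \<Rightarrow> base_point \<Rightarrow> (real \<Rightarrow> real \<Rightarrow> complex) \<Rightarrow> bool" where
  "joins x y H \<longleftrightarrow> (\<forall>s\<in>{0..1}. \<forall>t\<in>{0<..<1}. H s t \<in> thrice_punctured) \<and>
     departs x H \<and> departs y (\<lambda>s. reversepath (H s))"

definition tpath :: "base_point \<Rightarrow> base_point \<Rightarrow> (real \<Rightarrow> complex) \<Rightarrow> bool" where
  "tpath x y g \<longleftrightarrow> valid_path g \<and> joins x y (\<lambda>_. g)"

definition homotopy_rel ::
    "base_point \<Rightarrow> base_point \<Rightarrow> ((real \<Rightarrow> complex) \<times> (real \<Rightarrow> complex)) set" where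
  "homotopy_rel x y = {(g, h). tpath x y g \<and> tpath x y h \<and>
     (\<exists>H. continuous_on ({0..1} \<times> {0..1}) (\<lambda>(s, t). H s t) \<and> joins x y H \<and>
          (\<forall>t\<in>{0..1}. H 0 t = g t) \<and> (\<forall>t\<in>{0..1}. H 1 t = h t))}"

definition pi1_top :: "base_point \<Rightarrow> base_point \<Rightarrow> (real \<Rightarrow> complex) set set" where
  "pi1_top x y = {g. tpath x y g} // homotopy_rel x y"

(* Concatenation of g1 and g2, cutting off a small piece of both paths at the point where they
   meet, which may be a puncture. If g1 ends at and g2 starts from the same tangential base point,
   then for small e the ends of the pieces lie in a narrow convex sector at the puncture, so that
   the connecting segment avoids the puncture. *)
definition concat_cut ::
    "real \<Rightarrow> (real \<Rightarrow> complex) \<Rightarrow> (real \<Rightarrow> complex) \<Rightarrow> real \<Rightarrow> complex" where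
  "concat_cut e g1 g2 =
     subpath 0 (1 - e) g1 +++ (linepath (g1 (1 - e)) (g2 e) +++ subpath e 1 g2)"

(* The product (first G1, then G2) of two classes with a common base point in the middle;
   x is the start of G1 and y the end of G2. *)
definition pi1_mult :: "base_point \<Rightarrow> base_point \<Rightarrow>
    (real \<Rightarrow> complex) set \<Rightarrow> (real \<Rightarrow> complex) set \<Rightarrow> (real \<Rightarrow> complex) set" where
  "pi1_mult x y G1 G2 = {h. \<exists>g1\<in>G1. \<exists>g2\<in>G2.
     eventually (\<lambda>e. (concat_cut e g1 g2, h) \<in> homotopy_rel x y) (at_right 0)}"

(* The image of a class under f, where x and y are the end points of the image. *)
definition pi1_map :: "(complex \<Rightarrow> complex) \<Rightarrow> base_point \<Rightarrow> base_point \<Rightarrow>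
    (real \<Rightarrow> complex) set \<Rightarrow> (real \<Rightarrow> complex) set" where
  "pi1_map f x y G = homotopy_rel x y `` ((\<lambda>g. f \<circ> g) ` G)"

definition base_01 :: base_point where "base_01 = Tangential 0 1"

definition base_0inf :: base_point where "base_0inf = Tangential 0 (- 1)"

(* At time t the representative has argument pi * t; it traverses the circle with centre i/4
   and radius 1/4. *)
definition delta :: "(real \<Rightarrow> complex) set" where
  "delta = homotopy_rel base_01 base_0inf `` {\<lambda>t. rcis (sin (pi * t) / 2) (pi * t)}"

definition phi :: "complex \<Rightarrow> complex" where "phi z = z / (z - 1)"

definition multi_index :: "nat list \<Rightarrow> bool" where
  "multi_index k \<longleftrightarrow> k \<noteq> [] \<and> (\<forall>n\<in>set k. n \<ge> 1)"

abbreviation dp :: "nat list \<Rightarrow> nat" where "dp \<equiv> length"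

definition refinement :: "nat list \<Rightarrow> nat list \<Rightarrow> bool" where
  "refinement J k \<longleftrightarrow> (\<exists>m. length m = length k \<and> (\<forall>n\<in>set m. n \<ge> 1) \<and> sum_list m = length J \<and>
     (\<forall>i<length k. k ! i = (\<Sum>q<m ! i. J ! (sum_list (take i m) + q))))"

(* polylog_rev g k t is Li along the part of g from 0 to t. The multi-index is given in reversed
   order, so that the entry k_d on which the recursion operates is the head. The value 1 at the
   empty list turns the formula for Li_1 into an instance of the one for k_d = 1; the equation
   for the entry 0 is irrelevant for multi-indices. *)
fun polylog_rev :: "(real \<Rightarrow> complex) \<Rightarrow> nat list \<Rightarrow> real \<Rightarrow> complex" where
  "polylog_rev g [] t = 1"
| "polylog_rev g (0 # ks) t = 0"
| "polylog_rev g (Suc 0 # ks) t =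
     integral {0..t} (\<lambda>s. 1 / (1 - g s) * polylog_rev g ks s * vector_derivative g (at s))"
| "polylog_rev g (Suc (Suc k) # ks) t =
     integral {0..t} (\<lambda>s. 1 / g s * polylog_rev g (Suc k # ks) s * vector_derivative g (at s))"

definition polylog_path :: "nat list \<Rightarrow> (real \<Rightarrow> complex) \<Rightarrow> complex" where
  "polylog_path k g = polylog_rev g (rev k) 1"

(* The common value on all representatives of the class G. The argument z of Li_k(z; G) is the
   end point of G. *)
definition polylog :: "nat list \<Rightarrow> (real \<Rightarrow> complex) set \<Rightarrow> complex" where
  "polylog k G = (THE v. \<forall>g\<in>G. polylog_path k g = v)"

end

theory Submission
  imports Defs "HOL-Complex_Analysis.Complex_Analysis"
begin

text \<open>
  Put q = phi \<circ> g for a path g from the tangential base point 01 to z. Two things have to be shown: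
  that the value of a polylogarithm along delta followed by q is its value along q itself, and that the
  value along q is the asserted sum over refinements.

  For the first, all the polylogarithms are holomorphic and single valued on the unit disc, including
  the centre, because every iterated integral ends (on the inside) with the form dt/(1-t). So a piece
  of a path that stays in the unit disc can be changed at will, and the half turn in front of q has no
  effect. Nothing therefore needs to be regularized at the tangential base point: q starts at the
  puncture 0, too, and its iterated integrals converge as they stand. The directions at 0 matter only
  for the existence of the product of delta and phi(gamma), and for its independence of the
  representatives: there the short connecting segment must avoid 0.

  For the second, phi pulls the form dt/(1-t) back to -dt/(1-t) and the form dt/t back to
  dt/t + dt/(1-t). Expanding an iterated integral along q accordingly gives the sign (-1)^d, one factor
  for each dt/(1-t), and one summand for each choice of replacing some of the dt/t by dt/(1-t).
  Replacing dt/t by dt/(1-t) cuts an entry of the multi-index in two, so that these summands are the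
  refinements (polylog_rev_phi, refinements_eq_rev_refinements).

  The analytic core is the invariance of the iterated integrals under homotopy. The homotopy H is only
  continuous, so that one cannot integrate along its intermediate paths. Instead the integrals are
  continued analytically along H over the whole parameter square: at every parameter x there is a
  function holomorphic on a convex neighbourhood B x of H x, and for close parameters these functions
  agree where both are defined. Such a family has a primitive of the same kind, because the square is
  convex (ex_primitive); iterating this along the recursion for the polylogarithms gives the
  continuations, and on the piecewise smooth ends of the homotopy the fundamental theorem of calculus
  identifies them with the iterated integrals (polylog_rev_eq_continuation). At the common end point
  the continuations do not depend on the homotopy parameter, since they are locally constant in it
  (polylog_path_homotopy_invariant).
\<close>

section \<open>Primitives along a continuous map\<close>

text \<open>
  On a convex set every cocycle of local increments is a coboundary. F x adds up the increments along the
  segment from x0 to x, cut into N equal steps. Moving the end point from x to y moves the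
  partition points by at most the distance of x and y, and the cocycle condition on each of the small
  quadrilaterals makes the change of the sum telescope.
\<close>

lemma local_increments_integrate:
  fixes Q :: "'a::real_normed_vector set" and D :: "'a \<Rightarrow> 'a \<Rightarrow> 'b::real_vector"
  assumes "convex Q" "bounded Q" "d > 0" "x0 \<in> Q"
    and add: "\<And>x y z. \<lbrakk>x \<in> Q; y \<in> Q; z \<in> Q; dist x y < d; dist y z < d; dist x z < d\<rbrakk>
      \<Longrightarrow> D x y + D y z = D x z"
  obtains F where "F x0 = 0"
    "\<And>x y. \<lbrakk>x \<in> Q; y \<in> Q; dist x y < d\<rbrakk> \<Longrightarrow> F y - F x = D x y"
proof -
  obtain M where M: "M > 0" "\<And>x. x \<in> Q \<Longrightarrow> norm (x - x0) \<le> M"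
    using \<open>bounded Q\<close> by (metis bounded_any_center dist_norm norm_minus_commute 
        less_le_trans zero_less_one max.cobounded1 max.coboundedI2)
  obtain N :: nat where N: "real N > 2 * M / d"
    using reals_Archimedean2 by blast
  have "2 * M / d > 0" using M \<open>d > 0\<close> by simp
  with N have "N > 0" by (cases N) auto
  define p where "p x j = x0 + (real j / real N) *\<^sub>R (x - x0)" for x j
  have p_in: "p x j \<in> Q" if "x \<in> Q" "j \<le> N" for x j
  proof -
    have "p x j = (1 - real j / real N) *\<^sub>R x0 + (real j / real N) *\<^sub>R x"
      by (simp add: p_def algebra_simps)
    then show ?thesis
      using that \<open>N > 0\<close> \<open>x0 \<in> Q\<close> convexD[OF \<open>convex Q\<close>, of x0 x "1 - real j / real N" "real j / real N"]
      by auto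
  qed
  have p_step: "dist (p x j) (p x (Suc j)) < d / 2" if "x \<in> Q" for x j
  proof -
    have "p x (Suc j) - p x j = (1 / real N) *\<^sub>R (x - x0)"
      by (simp add: p_def add_divide_distrib scaleR_left_distrib)
    then have "dist (p x j) (p x (Suc j)) = norm (x - x0) / real N"
      by (simp add: dist_norm norm_minus_commute[of "p x j"])
    also have "\<dots> \<le> M / real N"
      using M that by (simp add: divide_right_mono)
    also have "\<dots> < d / 2"
      using N \<open>N > 0\<close> \<open>d > 0\<close> by (simp add: field_simps)
    finally show ?thesis .
  qed
  have p_near: "dist (p x j) (p y j) \<le> dist x y" if "j \<le> N" for x y j
  proof -
    have "p x j - p y j = (real j / real N) *\<^sub>R (x - y)"
      by (simp add: p_def algebra_simps)
    then have "dist (p x j) (p y j) = (real j / real N) * dist x y"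
      by (simp add: dist_norm)
    also have "\<dots> \<le> 1 * dist x y"
      using that \<open>N > 0\<close> by (intro mult_right_mono) auto
    finally show ?thesis by simp
  qed
  define F where "F x = (\<Sum>j<N. D (p x j) (p x (Suc j)))" for x
  have refl: "D x x = 0" if "x \<in> Q" for x
    using add[of x x x] that \<open>d > 0\<close> by simp
  have half: "F y - F x = D x y" if xy: "x \<in> Q" "y \<in> Q" "dist x y < d / 2" for x y
  proof -
    have "D (p y j) (p y (Suc j)) - D (p x j) (p x (Suc j))
        = D (p x (Suc j)) (p y (Suc j)) - D (p x j) (p y j)" if "j < N" for j
    proof -
      have near: "dist (p x i) (p y i) < d / 2" if "i \<le> N" for i
        using p_near[OF that, of x y] xy by simp
      have "dist (p x j) (p y (Suc j)) < d"
        using near[of j] p_step[of y j] xy that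
          dist_triangle_half_r[of "p y j" "p x j" d "p y (Suc j)"] 
        by (auto simp: dist_commute)
      then have "D (p x j) (p y j) + D (p y j) (p y (Suc j)) = D (p x j) (p y (Suc j))"
        "D (p x j) (p x (Suc j)) + D (p x (Suc j)) (p y (Suc j)) = D (p x j) (p y (Suc j))"
        using p_in[of x j] p_in[of y j] p_in[of x "Suc j"] p_in[of y "Suc j"] that xy
          near[of j] near[of "Suc j"] p_step[of x j] p_step[of y j] \<open>d > 0\<close>
        by (intro add; simp)+
      then show ?thesis by (simp add: algebra_simps)
    qed
    then have "F y - F x = (\<Sum>j<N. D (p x (Suc j)) (p y (Suc j)) - D (p x j) (p y j))"
      by (simp add: F_def flip: sum_subtractf)
    also have "\<dots> = D (p x N) (p y N) - D (p x 0) (p y 0)"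
      by (rule sum_lessThan_telescope)
    also have "\<dots> = D x y"
      using \<open>N > 0\<close> refl[OF \<open>x0 \<in> Q\<close>] by (simp add: p_def)
    finally show ?thesis .
  qed
  show ?thesis
  proof
    show "F x0 = 0"
      using refl[OF \<open>x0 \<in> Q\<close>] by (simp add: F_def p_def)
    fix x y assume xy: "x \<in> Q" "y \<in> Q" "dist x y < d"
    \<comment> \<open>The quadrilaterals above have diagonals below d if x and y are closer than d/2;
        the midpoint halves the distance.\<close>
    define m where "m = midpoint x y"
    have "m \<in> Q"
      using xy convexD[OF \<open>convex Q\<close>, of x y "1/2" "1/2"]
      by (simp add: m_def midpoint_def scaleR_add_right)
    moreover have "dist x m < d / 2" "dist m y < d / 2"
      using xy by (simp_all add: m_def dist_midpoint)
    ultimately have m: "m \<in> Q" "dist x m < d / 2" "dist m y < d / 2"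
      by auto
    have "F y - F x = (F m - F x) + (F y - F m)" by simp
    also have "\<dots> = D x m + D m y"
      using half m xy by simp
    also have "\<dots> = D x y"
      using m xy \<open>d > 0\<close> by (intro add; linarith)
    finally show "F y - F x = D x y" .
  qed
qed

text \<open>
  The parameter set Q carries a map H into the plane; the set B x is a neighbourhood of H x
  on which functions are to be defined, and it contains the values of H at all parameters closer than
  d to x. The neighbourhoods omit the singularity 1. They may contain 0, but then only at parameters that are
  connected with the base parameter x0; this will fix the value 0 at the point 0 of all
  primitives, and hence make the quotient by the coordinate holomorphic there.
\<close>

locale germ_cover =
  fixes Q :: "'a::real_normed_vector set" and H :: "'a \<Rightarrow> complex"
    and B :: "'a \<Rightarrow> complex set" and d :: real and x0 :: 'a
  assumes Q: "convex Q" "bounded Q" and d: "d > 0"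
    and B: "\<And>x. x \<in> Q \<Longrightarrow> open (B x)" "\<And>x. x \<in> Q \<Longrightarrow> convex (B x)"
    and near: "\<And>x y. \<lbrakk>x \<in> Q; y \<in> Q; dist x y < d\<rbrakk> \<Longrightarrow> H y \<in> B x"
    and no_1: "\<And>x. x \<in> Q \<Longrightarrow> 1 \<notin> B x"
    and disc: "connected {x \<in> Q. 0 \<in> B x}" "x0 \<in> Q" "0 \<in> B x0" "H x0 = 0"
begin

text \<open>
  A section assigns to each parameter x a holomorphic function on B x rather than a number:
  if H is constant on some part of Q, for instance, then the values alone do not determine
  an analytic continuation.
\<close>

definition germ_section :: "('a \<Rightarrow> complex \<Rightarrow> complex) \<Rightarrow> bool" where
  "germ_section f \<longleftrightarrow> (\<forall>x\<in>Q. f x holomorphic_on B x) \<and>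
     (\<forall>x\<in>Q. \<forall>y\<in>Q. dist x y < d \<longrightarrow> (\<forall>w\<in>B x \<inter> B y. f x w = f y w))"

definition primitive_of :: "('a \<Rightarrow> complex \<Rightarrow> complex) \<Rightarrow> ('a \<Rightarrow> complex \<Rightarrow> complex) \<Rightarrow> bool" where
  "primitive_of f k \<longleftrightarrow> germ_section k \<and> k x0 0 = 0 \<and>
     (\<forall>x\<in>Q. \<forall>w\<in>B x. (k x has_field_derivative f x w) (at w))"

lemma germ_section_eq:
  "\<lbrakk>germ_section f; x \<in> Q; y \<in> Q; dist x y < d; w \<in> B x; w \<in> B y\<rbrakk> \<Longrightarrow> f x w = f y w"
  by (auto simp: germ_section_def)

lemma germ_section_holomorphic: "\<lbrakk>germ_section f; x \<in> Q\<rbrakk> \<Longrightarrow> f x holomorphic_on B x"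
  by (simp add: germ_section_def)

text \<open>
  On each of the convex sets B x the function f x has a primitive P x, and the primitives for close
  parameters differ by a constant. So the increments of the local primitives satisfy the cocycle
  condition, and local_increments_integrate provides the constants that make them fit together.
\<close>

lemma ex_primitive:
  assumes f: "germ_section f"
  shows "\<exists>k. primitive_of f k"
proof -
  have "\<exists>g. \<forall>w\<in>B x. (g has_field_derivative f x w) (at w)" if "x \<in> Q" for x
  proof -
    have "f x holomorphic_on B x" using f that by (simp add: germ_section_def)
    from holomorphic_convex_primitive'[OF B(2)[OF that] B(1)[OF that] this]
    obtain g where "\<And>w. w \<in> B x \<Longrightarrow> (g has_field_derivative f x w) (at w within B x)"
      by blast
    then show ?thesis using at_within_open[OF _ B(1)[OF that]] by (intro exI[of _ g]) simp
  qed
  then obtain P where P: "\<And>x w. \<lbrakk>x \<in> Q; w \<in> B x\<rbrakk> \<Longrightarrow> (P x has_field_derivative f x w) (at w)"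
    by metis
  have self: "H x \<in> B x" if "x \<in> Q" for x
    using near[of x x] that d by simp
  have const: "P x w - P x v = P y w - P y v"
    if "x \<in> Q" "y \<in> Q" "dist x y < d" "w \<in> B x \<inter> B y" "v \<in> B x \<inter> B y" for x y v w
  proof -
    have "((\<lambda>w. P x w - P y w) has_field_derivative 0) (at u within B x \<inter> B y)"
      if "u \<in> B x \<inter> B y" for u
      using DERIV_diff[OF P[of x u] P[of y u]] germ_section_eq[OF f, of x y u] that \<open>x \<in> Q\<close> \<open>y \<in> Q\<close>
        \<open>dist x y < d\<close> by (auto intro: has_field_derivative_at_within)
    then have "\<exists>c. \<forall>u\<in>B x \<inter> B y. P x u - P y u = c"
      using B that by (intro has_field_derivative_zero_constant) (auto intro: convex_Int)
    then obtain c where "\<And>u. u\<in>B x \<inter> B y \<Longrightarrow> P x u - P y u = c" by blast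
    from this[OF that(4)] this[OF that(5)] show ?thesis
      by (simp add: algebra_simps)
  qed
  define D where "D x y = P x (H y) - P x (H x)" for x y
  obtain F where F: "F x0 = 0" "\<And>x y. \<lbrakk>x \<in> Q; y \<in> Q; dist x y < d\<rbrakk> \<Longrightarrow> F y - F x = D x y"
  proof (rule local_increments_integrate[OF Q d disc(2), of D])
    fix x y z assume h: "x \<in> Q" "y \<in> Q" "z \<in> Q" "dist x y < d" "dist y z < d" "dist x z < d"
    have "P x (H z) - P x (H y) = P y (H z) - P y (H y)"
      using h self near by (intro const) auto
    then show "D x y + D y z = D x z" by (simp add: D_def algebra_simps)
  qed (use that in blast)
  define k where "k x w = P x w + (F x - P x (H x))" for x w
  have k': "(k x has_field_derivative f x w) (at w)" if "x \<in> Q" "w \<in> B x" for x w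
    unfolding k_def by (auto intro!: derivative_eq_intros P that)
  have "germ_section k"
    unfolding germ_section_def
  proof (intro conjI ballI impI)
    fix x assume "x \<in> Q"
    then show "k x holomorphic_on B x"
      using k' B by (auto simp: holomorphic_on_open)
  next
    fix x y w assume h: "x \<in> Q" "y \<in> Q" "dist x y < d" "w \<in> B x \<inter> B y"
    have "P x w - P x (H y) = P y w - P y (H y)"
      using h near self by (intro const) auto
    moreover have "F y - F x = P x (H y) - P x (H x)"
      using F(2)[OF h(1-3)] by (simp add: D_def)
    ultimately show "k x w = k y w" unfolding k_def by (simp add: algebra_simps)
  qed
  moreover have "k x0 0 = 0" using F disc by (simp add: k_def)
  ultimately show ?thesis unfolding primitive_of_def using k' by blast
qed

definition primitive :: "('a \<Rightarrow> complex \<Rightarrow> complex) \<Rightarrow> 'a \<Rightarrow> complex \<Rightarrow> complex" where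
  "primitive f = (SOME k. primitive_of f k)"

lemma primitive:
  assumes "germ_section f"
  shows "primitive_of f (primitive f)"
  unfolding primitive_def by (rule someI_ex[OF ex_primitive[OF assms]])

lemma primitive_0:
  assumes "primitive_of f k" "x \<in> Q" "0 \<in> B x"
  shows "k x 0 = 0"
proof -
  let ?Z = "{x \<in> Q. 0 \<in> B x}"
  have "k x0 0 = k x 0"
  proof (rule connected_equivalence_relation[OF disc(1), of x0 x "\<lambda>x y. k x 0 = k y 0"])
    fix a assume a: "a \<in> ?Z"
    show "\<exists>T. openin (top_of_set ?Z) T \<and> a \<in> T \<and> (\<forall>x\<in>T. k a 0 = k x 0)"
      using a d assms
      by (intro exI[of _ "?Z \<inter> ball a d"]) (auto simp: primitive_of_def intro: germ_section_eq)
  qed (use assms disc in auto)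
  then show ?thesis using assms by (simp add: primitive_of_def)
qed

text \<open>
  The quotient by the coordinate, with the singularity at 0 removed; the value there is the right one
  for functions that vanish at 0.
\<close>

definition div_id :: "('a \<Rightarrow> complex \<Rightarrow> complex) \<Rightarrow> 'a \<Rightarrow> complex \<Rightarrow> complex" where
  "div_id f x w = (if w = 0 then deriv (f x) 0 else f x w / w)"

lemma germ_section_div_id:
  assumes f: "germ_section f" and 0: "\<And>x. \<lbrakk>x \<in> Q; 0 \<in> B x\<rbrakk> \<Longrightarrow> f x 0 = 0"
  shows "germ_section (div_id f)"
  unfolding germ_section_def
proof (intro conjI ballI impI)
  fix x assume x: "x \<in> Q"
  have hol: "f x holomorphic_on B x" using f x by (simp add: germ_section_def)
  show "div_id f x holomorphic_on B x"
  proof (cases "0 \<in> B x")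
    case True
    then have "(\<lambda>w. if w = 0 then deriv (f x) 0 else (f x w - f x 0) / (w - 0)) holomorphic_on B x"
      using B[OF x] by (intro pole_lemma hol) (auto simp: interior_open)
    then show ?thesis
      by (rule holomorphic_transform) (simp add: div_id_def 0[OF x True])
  next
    case False
    then have "(\<lambda>w. f x w / w) holomorphic_on B x"
      by (intro holomorphic_intros hol) auto
    then show ?thesis
      by (rule holomorphic_transform) (use False in \<open>auto simp: div_id_def\<close>)
  qed
next
  fix x y w assume h: "x \<in> Q" "y \<in> Q" "dist x y < d" "w \<in> B x \<inter> B y"
  have "deriv (f x) w = deriv (f y) w"
  proof (rule deriv_cong_ev[OF _ refl])
    show "\<forall>\<^sub>F w in nhds w. f x w = f y w"
      using h B germ_section_eq[OF f h(1-3)] by (auto simp: eventually_nhds intro!: exI[of _ "B x \<inter> B y"])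
  qed
  then show "div_id f x w = div_id f y w"
    using germ_section_eq[OF f h(1-3)] h by (auto simp: div_id_def)
qed

lemma germ_section_div_one_minus:
  assumes "germ_section f"
  shows "germ_section (\<lambda>x w. f x w / (1 - w))"
  using assms no_1 unfolding germ_section_def
  by (auto intro!: holomorphic_intros)

text \<open>
  The analytic continuations of the multiple polylogarithms along H. As in the recursion for the
  iterated integrals, the multi-index is reversed.
\<close>

fun continuation :: "nat list \<Rightarrow> 'a \<Rightarrow> complex \<Rightarrow> complex" where
  "continuation [] = (\<lambda>x w. 1)"
| "continuation (0 # ks) = (\<lambda>x w. 0)"
| "continuation (Suc 0 # ks) = primitive (\<lambda>x w. continuation ks x w / (1 - w))"
| "continuation (Suc (Suc k) # ks) = primitive (div_id (continuation (Suc k # ks)))"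

text \<open>
  The vanishing at 0 is part of the induction, because without it the division by the coordinate would
  not lead to a section again.
\<close>

lemma germ_section_continuation:
  "germ_section (continuation ks) \<and>
   (ks \<noteq> [] \<longrightarrow> (\<forall>x\<in>Q. 0 \<in> B x \<longrightarrow> continuation ks x 0 = 0))"
proof (induction ks rule: continuation.induct)
  case 1
  then show ?case by (simp add: germ_section_def)
next
  case (2 ks)
  then show ?case by (simp add: germ_section_def)
next
  case (3 ks)
  then have "primitive_of (\<lambda>x w. continuation ks x w / (1 - w)) (continuation (Suc 0 # ks))"
    by (simp add: primitive germ_section_div_one_minus)
  then show ?case
    using primitive_0 by (auto simp: primitive_of_def)
next
  case (4 k ks)
  then have "primitive_of (div_id (continuation (Suc k # ks))) (continuation (Suc (Suc k) # ks))"
    by (simp add: primitive germ_section_div_id)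
  then show ?case
    using primitive_0 by (auto simp: primitive_of_def)
qed

lemma DERIV_continuation:
  assumes "x \<in> Q" "w \<in> B x"
  shows "(continuation (Suc 0 # ks) x has_field_derivative continuation ks x w / (1 - w)) (at w)"
    and "w \<noteq> 0 \<Longrightarrow> (continuation (Suc (Suc k) # ks) x has_field_derivative
           continuation (Suc k # ks) x w / w) (at w)"
proof -
  have "primitive_of (\<lambda>x w. continuation ks x w / (1 - w)) (continuation (Suc 0 # ks))"
    by (simp add: primitive germ_section_div_one_minus germ_section_continuation)
  then show "(continuation (Suc 0 # ks) x has_field_derivative continuation ks x w / (1 - w)) (at w)"
    using assms by (simp add: primitive_of_def)
  have "primitive_of (div_id (continuation (Suc k # ks))) (continuation (Suc (Suc k) # ks))"
    by (simp add: primitive germ_section_div_id germ_section_continuation)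
  then have "(continuation (Suc (Suc k) # ks) x has_field_derivative
      div_id (continuation (Suc k # ks)) x w) (at w)"
    using assms unfolding primitive_of_def by blast
  then show "w \<noteq> 0 \<Longrightarrow> (continuation (Suc (Suc k) # ks) x has_field_derivative
           continuation (Suc k # ks) x w / w) (at w)"
    by (simp add: div_id_def)
qed

end

section \<open>Homotopy invariance of the iterated integrals\<close>

context germ_cover
begin

text \<open>
  Along a piecewise smooth path the continuations are primitives of the integrands, up to finitely many
  exceptions, and they are continuous up to the singular starting point. So the fundamental theorem of
  calculus for the gauge integral gives the iterated integrals, even if the path has infinite length
  near 0. The curve c embeds the time interval isometrically into the parameter set.
\<close>

lemma polylog_rev_eq_continuation:
  assumes g: "valid_path g" "g 0 = 0" "\<And>t. \<lbrakk>0 < t; t \<le> 1\<rbrakk> \<Longrightarrow> g t \<noteq> 0"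
    and c: "\<And>t. t \<in> {0..1} \<Longrightarrow> c t \<in> Q" "\<And>t. t \<in> {0..1} \<Longrightarrow> H (c t) = g t"
      "\<And>t u. dist (c t) (c u) = dist t u" "0 \<in> B (c 0)"
    and t: "0 \<le> t" "t \<le> 1"
  shows "polylog_rev g ks t = continuation ks (c t) (g t)"
    and "((\<lambda>s. 1 / (1 - g s) * polylog_rev g ks s * vector_derivative g (at s))
           has_integral polylog_rev g (Suc 0 # ks) t) {0..t}"
    and "((\<lambda>s. 1 / g s * polylog_rev g (Suc k # ks) s * vector_derivative g (at s))
           has_integral polylog_rev g (Suc (Suc k) # ks) t) {0..t}"
proof -
  define F where "F ks t = continuation ks (c t) (g t)" for ks t
  have gB: "g u \<in> B (c t)" if "t \<in> {0..1}" "u \<in> {0..1}" "dist t u < d" for t u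
    using near[OF c(1)[OF that(1)] c(1)[OF that(2)]] that(3) by (simp add: c(3) c(2)[OF that(2)])
  \<comment> \<open>Near t the values of F come from a single holomorphic function, so that F can be differentiated.\<close>
  have local: "continuation ks (c t) (g u) = F ks u"
    if "t \<in> {0..1}" "u \<in> {0..1}" "dist t u < d" for ks t u
    unfolding F_def
  proof (rule germ_section_eq)
    show "g u \<in> B (c t)" "g u \<in> B (c u)"
      using gB[of t u] gB[of u u] that d by auto
  qed (use that c germ_section_continuation in auto)
  obtain S where S: "finite S" "g C1_differentiable_on {0..1} - S"
    and contg: "continuous_on {0..1} g"
    using g by (auto simp: valid_path_def piecewise_C1_differentiable_on_def)
  have g': "(g has_vector_derivative vector_derivative g (at u)) (at u)" if "u \<in> {0..1} - S" for u
    using S that by (auto simp: C1_differentiable_on_eq vector_derivative_works)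
  have contF: "continuous_on {0..1} (F ks)" for ks
    unfolding continuous_on_eq_continuous_within
  proof
    fix t :: real assume t: "t \<in> {0..1}"
    have "continuous_on (B (c t)) (continuation ks (c t))"
      by (rule holomorphic_on_imp_continuous_on[OF germ_section_holomorphic
            [OF conjunct1[OF germ_section_continuation] c(1)[OF t]]])
    moreover have "g t \<in> B (c t)"
      using gB[OF t t] d by simp
    ultimately have "isCont (continuation ks (c t)) (g t)"
      using continuous_on_eq_continuous_at[OF B(1)[OF c(1)[OF t]]] by blast
    moreover have "continuous (at t within {0..1}) g"
      using contg t by (simp add: continuous_on_eq_continuous_within)
    ultimately have "continuous (at t within {0..1}) (\<lambda>u. continuation ks (c t) (g u))"
      by (rule continuous_within_compose3)
    then show "continuous (at t within {0..1}) (F ks)"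
    proof (rule continuous_transform_within[OF _ d t])
      fix u assume "u \<in> {0..1}" "dist u t < d"
      then show "continuation ks (c t) (g u) = F ks u"
        using local[OF t, of u] by (simp add: dist_commute)
    qed
  qed
  have F': "(F ks has_vector_derivative vector_derivative g (at u) * D) (at u)"
    if u: "0 < u" "u < 1" "u \<notin> S"
      and D: "(continuation ks (c u) has_field_derivative D) (at (g u))" for ks u D
  proof -
    have "(continuation ks (c u) \<circ> g has_vector_derivative vector_derivative g (at u) * D) (at u)"
      using g'[of u] u D by (intro field_vector_diff_chain_at) auto
    then show ?thesis
    proof (rule has_vector_derivative_transform_within_open)
      show "open ({0<..<1} \<inter> ball u d)" "u \<in> {0<..<1} \<inter> ball u d"
        using u d by auto
      fix v assume "v \<in> {0<..<1} \<inter> ball u d"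
      then show "(continuation ks (c u) \<circ> g) v = F ks v"
        using local[of u v ks] u by simp
    qed
  qed
  have D1: "(continuation (Suc 0 # ks) (c u) has_field_derivative F ks u / (1 - g u)) (at (g u))"
    if "0 < u" "u < 1" for ks u
    unfolding F_def using DERIV_continuation(1)[OF c(1) gB] that d by simp
  have D2: "(continuation (Suc (Suc k) # ks) (c u) has_field_derivative
      F (Suc k # ks) u / g u) (at (g u))" if "0 < u" "u < 1" for k ks u
    unfolding F_def using DERIV_continuation(2)[OF c(1) gB g(3)] that d by simp
  have F0: "F ks 0 = 0" if "ks \<noteq> []" for ks
    using conjunct2[OF germ_section_continuation[of ks]] that c(1)[of 0] c(4) by (simp add: F_def \<open>g 0 = 0\<close>)
  have F1: "((\<lambda>s. 1 / (1 - g s) * F ks s * vector_derivative g (at s))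
           has_integral F (Suc 0 # ks) t) {0..t}" if t: "0 \<le> t" "t \<le> 1" for ks t
  proof -
    have "((\<lambda>s. 1 / (1 - g s) * F ks s * vector_derivative g (at s))
           has_integral F (Suc 0 # ks) t - F (Suc 0 # ks) 0) {0..t}"
    proof (rule fundamental_theorem_of_calculus_interior_strong[OF S(1) t(1)])
      fix u assume u: "u \<in> {0<..<t} - S"
      then show "(F (Suc 0 # ks) has_vector_derivative
          1 / (1 - g u) * F ks u * vector_derivative g (at u)) (at u)"
        using F'[of u "Suc 0 # ks" "F ks u / (1 - g u)", OF _ _ _ D1] t
        by (simp add: mult.commute)
    qed (use t in \<open>auto intro: continuous_on_subset[OF contF]\<close>)
    then show ?thesis using F0 by simp
  qed
  have F2: "((\<lambda>s. 1 / g s * F (Suc k # ks) s * vector_derivative g (at s))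
           has_integral F (Suc (Suc k) # ks) t) {0..t}" if t: "0 \<le> t" "t \<le> 1" for k ks t
  proof -
    have "((\<lambda>s. 1 / g s * F (Suc k # ks) s * vector_derivative g (at s))
           has_integral F (Suc (Suc k) # ks) t - F (Suc (Suc k) # ks) 0) {0..t}"
    proof (rule fundamental_theorem_of_calculus_interior_strong[OF S(1) t(1)])
      fix u assume u: "u \<in> {0<..<t} - S"
      then show "(F (Suc (Suc k) # ks) has_vector_derivative
          1 / g u * F (Suc k # ks) u * vector_derivative g (at u)) (at u)"
        using F'[of u "Suc (Suc k) # ks" "F (Suc k # ks) u / g u", OF _ _ _ D2] t g(3)[of u]
        by (simp add: mult.commute)
    qed (use t in \<open>auto intro: continuous_on_subset[OF contF]\<close>)
    then show ?thesis using F0 by simp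
  qed
  have eq: "polylog_rev g ks t = F ks t" if t: "0 \<le> t" "t \<le> 1" for ks t
    using t
  proof (induction ks arbitrary: t rule: continuation.induct)
    case (3 ks)
    have "((\<lambda>s. 1 / (1 - g s) * polylog_rev g ks s * vector_derivative g (at s))
           has_integral F (Suc 0 # ks) t) {0..t}"
      using 3 by (intro has_integral_eq[OF _ F1]) simp_all
    then show ?case by (simp add: integral_unique)
  next
    case (4 k ks)
    have "((\<lambda>s. 1 / g s * polylog_rev g (Suc k # ks) s * vector_derivative g (at s))
           has_integral F (Suc (Suc k) # ks) t) {0..t}"
      using 4(2,3) by (intro has_integral_eq[OF _ F2]) (simp_all only: 4(1) atLeastAtMost_iff order_trans[of _ t 1])
    then show ?case by (simp add: integral_unique)
  qed (simp_all add: F_def)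
  show "polylog_rev g ks t = continuation ks (c t) (g t)"
    using eq t by (simp add: F_def)
  show "((\<lambda>s. 1 / (1 - g s) * polylog_rev g ks s * vector_derivative g (at s))
           has_integral polylog_rev g (Suc 0 # ks) t) {0..t}"
    unfolding eq[OF t] by (rule has_integral_eq[OF _ F1[OF t]]) (simp add: eq order_trans[OF _ t(2)])
  show "((\<lambda>s. 1 / g s * polylog_rev g (Suc k # ks) s * vector_derivative g (at s))
           has_integral polylog_rev g (Suc (Suc k) # ks) t) {0..t}"
    unfolding eq[OF t] by (rule has_integral_eq[OF _ F2[OF t]]) (simp add: eq order_trans[OF _ t(2)] del: polylog_rev.simps)
qed

end

text \<open>
  Up to time a the unit disc serves as neighbourhood, afterwards a disc that avoids both
  punctures. By compactness all the distances involved are bounded below.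
\<close>

lemma ex_germ_cover:
  fixes H :: "real \<Rightarrow> real \<Rightarrow> complex"
  assumes cont: "continuous_on ({0..1} \<times> {0..1}) (\<lambda>(s, t). H s t)"
    and start: "\<And>s. s \<in> {0..1} \<Longrightarrow> H s 0 = 0"
    and a: "0 < a" "a \<le> 1"
    and disc: "\<And>s t. \<lbrakk>s \<in> {0..1}; t \<in> {0..a}\<rbrakk> \<Longrightarrow> norm (H s t) < 1"
    and avoid: "\<And>s t. \<lbrakk>s \<in> {0..1}; t \<in> {a..1}\<rbrakk> \<Longrightarrow> H s t \<notin> {0, 1}"
  obtains B d where "germ_cover ({0..1} \<times> {0..1}) (\<lambda>(s, t). H s t) B d (0, 0)"
    "\<And>s. s \<in> {0..1} \<Longrightarrow> 0 \<in> B (s, 0)"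
proof -
  let ?H = "\<lambda>(s, t). H s t"
  let ?Q = "{0..1::real} \<times> {0..1::real}"
  have comp: "compact (?H ` ({0..1} \<times> T))" if "T \<subseteq> {0..1}" "compact T" for T
    using that by (intro compact_continuous_image[OF continuous_on_subset[OF cont]] compact_Times) auto
  have "?H ` ({0..1} \<times> {0..a}) \<inter> - ball 0 1 = {}"
    using disc by auto
  moreover have "closed (- ball 0 1 :: complex set)"
    by (intro closed_Compl open_ball)
  ultimately obtain r1 where r1: "r1 > 0" and far:
    "\<forall>x\<in>?H ` ({0..1} \<times> {0..a}). \<forall>y\<in>- ball 0 1. r1 \<le> dist x y"
    using separate_compact_closed comp[of "{0..a}"] a by (metis atLeastatMost_subset_iff
        compact_Icc order_refl)
  have r1_disc: "norm w < 1" if "s \<in> {0..1}" "t \<in> {0..a}" "dist (H s t) w < r1" for s t w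
  proof (rule ccontr)
    assume "\<not> norm w < 1"
    then have "r1 \<le> dist (H s t) w"
      using that by (intro far[rule_format]) auto
    then show False using that(3) by simp
  qed
  have "?H ` ({0..1} \<times> {a..1}) \<inter> {0, 1} = {}"
    using avoid by fastforce
  moreover have "closed ({0, 1} :: complex set)"
    by simp
  ultimately obtain r2 where r2: "r2 > 0" and far2:
    "\<forall>x\<in>?H ` ({0..1} \<times> {a..1}). \<forall>y\<in>{0, 1}. r2 \<le> dist x y"
    using separate_compact_closed comp[of "{a..1}"] a by (metis atLeastatMost_subset_iff
        compact_Icc order_refl less_imp_le)
  have r2_far: "r2 \<le> dist (H s t) 0" "r2 \<le> dist (H s t) 1" if "s \<in> {0..1}" "t \<in> {a..1}" for s t
    using far2 that by (auto simp del: dist_0_norm)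
  have "uniformly_continuous_on ?Q ?H"
    by (intro compact_uniformly_continuous cont compact_Times) auto
  moreover have "min r1 r2 > 0" using r1 r2 by simp
  ultimately obtain d where d: "d > 0"
    and d_near: "\<forall>x\<in>?Q. \<forall>y\<in>?Q. dist y x < d \<longrightarrow> dist (?H y) (?H x) < min r1 r2"
    unfolding uniformly_continuous_on_def by blast
  \<comment> \<open>The unit disc for all times up to a keeps the set of parameters x with 0 in B x connected.\<close>
  define B where "B x = (if snd x \<le> a then ball 0 1 else ball (?H x) r2)" for x :: "real \<times> real"
  have 0: "0 \<in> B (s, t) \<longleftrightarrow> t \<le> a" if "s \<in> {0..1}" "t \<in> {0..1}" for s t
    using r2_far(1)[of s t] that by (auto simp: B_def)
  then have Z: "{x \<in> ?Q. 0 \<in> B x} = {0..1} \<times> {0..a}"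
    using a by auto
  have "germ_cover ?Q ?H B d (0, 0)"
  proof
    fix x y assume xy: "x \<in> ?Q" "y \<in> ?Q" "dist x y < d"
    obtain s t where x: "x = (s, t)" by fastforce
    have *: "dist (H s t) (?H y) < min r1 r2"
      using d_near[rule_format, OF xy(2,1) xy(3)] by (simp add: x)
    show "?H y \<in> B x"
    proof (cases "t \<le> a")
      case True
      then show ?thesis
        using r1_disc[of s t "?H y"] * xy by (simp add: B_def x)
    next
      case False
      then show ?thesis using * by (simp add: B_def x)
    qed
  next
    fix x assume "x \<in> ?Q"
    then obtain s t where x: "x = (s, t)" "s \<in> {0..1}" "t \<in> {0..1}" by blast
    then show "1 \<notin> B x" using r2_far(2)[of s t] by (auto simp: B_def)
    show "open (B x)" "convex (B x)" by (simp_all add: B_def)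
  next
    show "connected {x \<in> ?Q. 0 \<in> B x}"
      unfolding Z by (intro convex_connected convex_Times convex_real_interval)
    show "0 \<in> B (0, 0)" using a by (simp add: B_def)
    show "?H (0, 0) = 0" using start by simp
    show "convex ?Q" by (intro convex_Times convex_real_interval)
    show "bounded ?Q" by (intro bounded_Times bounded_closed_interval)
  qed (use d in auto)
  then show ?thesis
    using that[of B d] a by (simp add: B_def)
qed

text \<open>
  Up to time a the homotopy may pass through 0, since the polylogarithms are holomorphic in the unit
  disc. This generality is what removes the half turn later on. Only the two end paths have to avoid 0,
  for otherwise the integrand 1/t would be evaluated at 0.
\<close>

lemma polylog_path_homotopy_invariant:
  fixes H :: "real \<Rightarrow> real \<Rightarrow> complex"
  assumes cont: "continuous_on ({0..1} \<times> {0..1}) (\<lambda>(s, t). H s t)"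
    and start: "\<And>s. s \<in> {0..1} \<Longrightarrow> H s 0 = 0"
    and finish: "\<And>s. s \<in> {0..1} \<Longrightarrow> H s 1 = z"
    and a: "0 < a" "a \<le> 1"
    and disc: "\<And>s t. \<lbrakk>s \<in> {0..1}; t \<in> {0..a}\<rbrakk> \<Longrightarrow> norm (H s t) < 1"
    and avoid: "\<And>s t. \<lbrakk>s \<in> {0..1}; t \<in> {a..1}\<rbrakk> \<Longrightarrow> H s t \<notin> {0, 1}"
    and g: "valid_path g" "\<And>t. \<lbrakk>0 < t; t \<le> 1\<rbrakk> \<Longrightarrow> g t \<noteq> 0" "\<And>t. t \<in> {0..1} \<Longrightarrow> H 0 t = g t"
    and h: "valid_path h" "\<And>t. \<lbrakk>0 < t; t \<le> 1\<rbrakk> \<Longrightarrow> h t \<noteq> 0" "\<And>t. t \<in> {0..1} \<Longrightarrow> H 1 t = h t"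
  shows "polylog_path k g = polylog_path k h"
proof -
  obtain B d where "germ_cover ({0..1} \<times> {0..1}) (\<lambda>(s, t). H s t) B d (0, 0)"
    and B0: "\<And>s. s \<in> {0..1} \<Longrightarrow> 0 \<in> B (s, 0)"
    using ex_germ_cover[OF cont start a disc avoid] by blast
  then interpret germ_cover "{0..1} \<times> {0..1}" "\<lambda>(s, t). H s t" B d "(0, 0)"
    by blast
  have end_value: "polylog_rev p ks 1 = continuation ks (s, 1) z"
    if p: "valid_path p" "\<And>t. \<lbrakk>0 < t; t \<le> 1\<rbrakk> \<Longrightarrow> p t \<noteq> 0" "\<And>t. t \<in> {0..1} \<Longrightarrow> H s t = p t"
      and s: "s \<in> {0..1}" for p s ks
  proof -
    have "p 0 = 0" "p 1 = z"
      using start[OF s] finish[OF s] p(3)[of 0] p(3)[of 1] by auto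
    then show ?thesis
      using polylog_rev_eq_continuation(1)[of p "Pair s" 1 ks] p s B0[OF s]
      by (simp add: dist_Pair_Pair)
  qed
  \<comment> \<open>All the paths end at z, where the continuation is locally constant in the homotopy parameter.\<close>
  have "continuation ks (0, 1) z = continuation ks (1, 1) z" for ks
  proof (rule connected_equivalence_relation
      [of "{0..1::real}" 0 1 "\<lambda>s s'. continuation ks (s, 1) z = continuation ks (s', 1) z"])
    fix s :: real assume s: "s \<in> {0..1}"
    have "continuation ks (s, 1) z = continuation ks (s', 1) z" if "s' \<in> {0..1}" "dist s s' < d" for s'
    proof (rule germ_section_eq)
      have "z \<in> B (r, 1)" if "r \<in> {0..1}" for r
        using near[of "(r, 1)" "(r, 1)"] finish[OF that] that d by simp
      then show "z \<in> B (s, 1)" "z \<in> B (s', 1)" using s that by auto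
    qed (use s that germ_section_continuation in \<open>auto simp: dist_Pair_Pair\<close>)
    then have "\<forall>s'\<in>{0..1} \<inter> ball s d. continuation ks (s, 1) z = continuation ks (s', 1) z"
      by (metis Int_iff mem_ball)
    moreover have "openin (top_of_set {0..1}) ({0..1} \<inter> ball s d)" "s \<in> {0..1} \<inter> ball s d"
      using s d by auto
    ultimately show "\<exists>T. openin (top_of_set {0..1}) T \<and> s \<in> T \<and>
        (\<forall>s'\<in>T. continuation ks (s, 1) z = continuation ks (s', 1) z)"
      by blast
  qed auto
  then show ?thesis
    using end_value[OF g, of "rev k"] end_value[OF h, of "rev k"] by (simp add: polylog_path_def)
qed

lemma small_near_start:
  fixes H :: "real \<Rightarrow> real \<Rightarrow> complex"
  assumes cont: "continuous_on ({0..1} \<times> {0..1}) (\<lambda>(s, t). H s t)"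
    and start: "\<And>s. s \<in> {0..1} \<Longrightarrow> H s 0 = 0" and "e > 0"
  obtains a where "0 < a" "a \<le> 1" "\<And>s t. \<lbrakk>s \<in> {0..1}; t \<in> {0..a}\<rbrakk> \<Longrightarrow> norm (H s t) < e"
proof -
  have "uniformly_continuous_on ({0..1} \<times> {0..1}) (\<lambda>(s, t). H s t)"
    by (intro compact_uniformly_continuous cont compact_Times) auto
  then obtain d where d: "d > 0" "\<And>x y. \<lbrakk>x \<in> {0..1} \<times> {0..1}; y \<in> {0..1} \<times> {0..1}; dist y x < d\<rbrakk> 
      \<Longrightarrow> dist ((\<lambda>(s, t). H s t) y) ((\<lambda>(s, t). H s t) x) < e"
    unfolding uniformly_continuous_on_def using \<open>e > 0\<close> by metis
  show ?thesis
  proof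
    fix s t :: real assume "s \<in> {0..1}" "t \<in> {0..min 1 (d / 2)}"
    then show "norm (H s t) < e"
      using d(2)[of "(s, 0)" "(s, t)"] start[of s] \<open>d > 0\<close> by (auto simp: dist_Pair_Pair)
  qed (use d in auto)
qed

text \<open>
  Integrability of the integrands, from the constant homotopy.
\<close>

lemma polylog_rev_has_integral:
  assumes g: "valid_path g" "g 0 = 0" "\<And>t. \<lbrakk>0 < t; t \<le> 1\<rbrakk> \<Longrightarrow> g t \<in> thrice_punctured"
    and t: "0 \<le> t" "t \<le> 1"
  shows "((\<lambda>s. 1 / (1 - g s) * polylog_rev g ks s * vector_derivative g (at s))
           has_integral polylog_rev g (Suc 0 # ks) t) {0..t}"
    and "((\<lambda>s. 1 / g s * polylog_rev g (Suc k # ks) s * vector_derivative g (at s))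
           has_integral polylog_rev g (Suc (Suc k) # ks) t) {0..t}"
proof -
  have "continuous_on {0..1} g"
    using g valid_path_imp_path by (auto simp: path_def)
  then have cont: "continuous_on ({0..1} \<times> {0..1}) (\<lambda>(s, t). (\<lambda>s::real. g) s t)"
    by (simp add: case_prod_unfold) (rule continuous_on_compose2[OF _ continuous_on_snd], auto)
  obtain a where a: "0 < a" "a \<le> 1" "\<And>(s::real) t. \<lbrakk>s \<in> {0..1}; t \<in> {0..a}\<rbrakk> \<Longrightarrow> norm (g t) < 1"
    by (rule small_near_start[where H = "\<lambda>_. g", OF cont g(2), of 1]) auto
  have avoid: "g t \<notin> {0, 1}" if "t \<in> {a..1}" for t
    using g(3)[of t] a(1) that by auto
  obtain B d where "germ_cover ({0..1} \<times> {0..1}) (\<lambda>(s::real, t). g t) B d (0, 0)"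
    and B0: "\<And>s. s \<in> {0..1} \<Longrightarrow> 0 \<in> B (s, 0)"
    by (rule ex_germ_cover[where H = "\<lambda>_. g", OF cont g(2) a avoid]) auto
  then interpret germ_cover "{0..1} \<times> {0..1}" "\<lambda>(s::real, t). g t" B d "(0, 0)"
    by blast
  show "((\<lambda>s. 1 / (1 - g s) * polylog_rev g ks s * vector_derivative g (at s))
           has_integral polylog_rev g (Suc 0 # ks) t) {0..t}"
    using polylog_rev_eq_continuation(2)[of g "Pair 0" t ks] g B0 t
    by (simp add: dist_Pair_Pair)
  show "((\<lambda>s. 1 / g s * polylog_rev g (Suc k # ks) s * vector_derivative g (at s))
           has_integral polylog_rev g (Suc (Suc k) # ks) t) {0..t}"
    using polylog_rev_eq_continuation(3)[of g "Pair 0" t k ks] g B0 t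
    by (simp add: dist_Pair_Pair)
qed

lemma polylog_path_homotopy_rel:
  assumes "(g, h) \<in> homotopy_rel base_01 (Pt z)" "z \<in> thrice_punctured"
  shows "polylog_path k g = polylog_path k h"
proof -
  obtain H :: "real \<Rightarrow> real \<Rightarrow> complex"
    where cont: "continuous_on ({0..1} \<times> {0..1}) (\<lambda>(s, t). H s t)"
      and joins: "joins base_01 (Pt z) H"
      and gh: "\<And>t. t \<in> {0..1} \<Longrightarrow> H 0 t = g t" "\<And>t. t \<in> {0..1} \<Longrightarrow> H 1 t = h t"
      and v: "valid_path g" "valid_path h"
    using assms(1) unfolding homotopy_rel_def tpath_def by blast
  have H: "\<And>s t. \<lbrakk>s \<in> {0..1}; 0 < t; t < 1\<rbrakk> \<Longrightarrow> H s t \<notin> {0,1}"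
      "\<And>s. s \<in> {0..1} \<Longrightarrow> H s 0 = 0" "\<And>s. s \<in> {0..1} \<Longrightarrow> H s 1 = z"
    using joins by (auto simp: joins_def base_01_def reversepath_def)
  have H1: "H s t \<notin> {0,1}" if "s \<in> {0..1}" "0 < t" "t \<le> 1" for s t
    using H(1,3)[of s] assms(2) that by (cases "t = 1") auto
  obtain a where a: "0 < a" "a \<le> 1" "\<And>s t. \<lbrakk>s \<in> {0..1}; t \<in> {0..a}\<rbrakk> \<Longrightarrow> norm (H s t) < 1"
    by (rule small_near_start[where H = H, OF cont H(2), of 1]) auto
  show ?thesis
  proof (rule polylog_path_homotopy_invariant[where H = H, OF cont H(2,3) a])
    fix t :: real assume "0 < t" "t \<le> 1"
    then show "g t \<noteq> 0" "h t \<noteq> 0"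
      using H1[of 0 t] H1[of 1 t] gh[of t] by auto
  qed (use H1 a v gh in auto)
qed

section \<open>Concatenation at a tangential base point\<close>

lemma joins_D:
  assumes "joins x y H" "s \<in> {0..1}"
  shows "\<And>t. \<lbrakk>0 < t; t < 1\<rbrakk> \<Longrightarrow> H s t \<notin> {0, 1}"
  using assms by (auto simp: joins_def)

lemma continuous_on_const_family:
  fixes g :: "real \<Rightarrow> complex"
  assumes "path g"
  shows "continuous_on ({0..1} \<times> {0..1}) (\<lambda>(s::real, t). g t)"
  using assms unfolding path_def case_prod_unfold
  by (rule continuous_on_compose2[OF _ continuous_on_snd]) auto

lemma homotopy_rel_refl:
  assumes "tpath x y g"
  shows "(g, g) \<in> homotopy_rel x y"
proof -
  have "continuous_on ({0..1} \<times> {0..1}) (\<lambda>(s::real, t). g t)"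
    using assms by (auto simp: tpath_def intro!: continuous_on_const_family valid_path_imp_path)
  then show ?thesis
    using assms unfolding homotopy_rel_def tpath_def by blast
qed

lemma departs_tangentialD:
  assumes "departs (Tangential a v) H" "r > 0"
  obtains b where "b > 0" "\<And>s t. \<lbrakk>s \<in> {0..1}; 0 < t; t < b\<rbrakk> \<Longrightarrow> dist (sgn (H s t - a)) v < r"
proof -
  have "\<forall>\<^sub>F t in at_right 0. \<forall>s\<in>{0..1}. dist (sgn (H s t - a)) v < r"
    using assms by (auto simp: uniform_limit_iff)
  then show ?thesis
    using that unfolding eventually_at_right_field by blast
qed

text \<open>
  If both end points of the connecting segment have this property, then the whole
  segment lies in an open half plane whose boundary passes through 0.
\<close>

lemma inner_pos_of_sgn_near:
  fixes p v :: "'a::real_inner"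
  assumes "norm v = 1" "dist (sgn p) v < 1"
  shows "inner p v > 0"
proof -
  have "(dist (sgn p) v)\<^sup>2 < 1"
    using assms(2) by (simp add: power_less_one_iff)
  moreover have "(dist (sgn p) v)\<^sup>2 = inner (sgn p) (sgn p) + 1 - 2 * inner (sgn p) v"
    using assms(1) by (simp add: dist_norm power2_norm_eq_inner inner_diff_left inner_diff_right
        inner_commute norm_eq_1)
  ultimately have "inner (sgn p) v > 0"
    using inner_ge_zero[of "sgn p"] by linarith
  moreover have "inner p v = norm p * inner (sgn p) v"
    by (cases "p = 0") (simp_all add: sgn_div_norm)
  ultimately show ?thesis
    by (metis inner_zero_left less_irrefl mult_pos_pos sgn_zero zero_less_norm_iff)
qed

lemma concat_cut_eq:
  "concat_cut e g1 g2 t =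
    (if t \<le> 1/2 then g1 ((1 - e) * (2 * t))
     else if t \<le> 3/4 then linepath (g1 (1 - e)) (g2 e) (4 * t - 2)
     else g2 ((1 - e) * (4 * t - 3) + e))"
  by (simp add: concat_cut_def joinpaths_def subpath_def algebra_simps)

lemma concat_cut_first_arg:
  fixes e t :: real
  assumes "0 < e" "e < 1" "0 \<le> t" "t \<le> 1/2"
  shows "0 \<le> (1 - e) * (2 * t)" "(1 - e) * (2 * t) \<le> 2 * t" "(1 - e) * (2 * t) < 1"
    "0 < t \<Longrightarrow> 0 < (1 - e) * (2 * t)"
proof -
  show "0 \<le> (1 - e) * (2 * t)" "0 < t \<Longrightarrow> 0 < (1 - e) * (2 * t)" using assms by simp_all
  have "(1 - e) * (2 * t) \<le> 1 * (2 * t)"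
    by (rule mult_right_mono) (use assms in auto)
  then show "(1 - e) * (2 * t) \<le> 2 * t" by linarith
  have "(1 - e) * (2 * t) \<le> (1 - e) * 1"
    by (rule mult_left_mono) (use assms in auto)
  also have "\<dots> < 1" using assms by simp
  finally show "(1 - e) * (2 * t) < 1" .
qed

lemma concat_cut_last_arg:
  fixes e t :: real
  assumes "0 < e" "e < 1" "3/4 \<le> t" "t \<le> 1"
  shows "e \<le> (1 - e) * (4 * t - 3) + e" "(1 - e) * (4 * t - 3) + e \<le> 1"
    "t < 1 \<Longrightarrow> (1 - e) * (4 * t - 3) + e < 1"
proof -
  have "0 \<le> (1 - e) * (4 * t - 3)"
    by (rule mult_nonneg_nonneg) (use assms in auto)
  then show "e \<le> (1 - e) * (4 * t - 3) + e" by linarith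
  have "(1 - e) * (4 * t - 3) \<le> (1 - e) * 1"
    by (rule mult_left_mono) (use assms in auto)
  then show "(1 - e) * (4 * t - 3) + e \<le> 1"
    unfolding mult_1_right le_diff_eq .
  assume "t < 1"
  then have "(1 - e) * (4 * t - 3) < (1 - e) * 1"
    by (intro mult_strict_left_mono) (use assms in auto)
  then show "(1 - e) * (4 * t - 3) + e < 1"
    unfolding mult_1_right less_diff_eq .
qed

text \<open>
  Concatenation with a variable cut e is compatible with homotopies. The ends of the two pieces come
  from the direction v, uniformly in the homotopy parameter, so that for all cuts below some b the
  connecting segments avoid the punctures simultaneously.
\<close>

lemma concat_cut_homotopy:
  fixes G1 G2 :: "real \<Rightarrow> real \<Rightarrow> complex"
  assumes cont1: "continuous_on ({0..1} \<times> {0..1}) (\<lambda>(s, t). G1 s t)"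
    and cont2: "continuous_on ({0..1} \<times> {0..1}) (\<lambda>(s, t). G2 s t)"
    and j1: "joins (Tangential c u) (Tangential 0 v) G1"
    and j2: "joins (Tangential 0 v) (Pt w) G2"
    and v: "norm v = 1"
  obtains b where "0 < b" "b < 1"
    "\<And>e. \<lbrakk>continuous_on {0..1} e; \<forall>s\<in>{0..1}. 0 < e s \<and> e s < b\<rbrakk> \<Longrightarrow>
       joins (Tangential c u) (Pt w) (\<lambda>s. concat_cut (e s) (G1 s) (G2 s)) \<and>
       continuous_on ({0..1} \<times> {0..1}) (\<lambda>(s, t). concat_cut (e s) (G1 s) (G2 s) t)"
proof -
  have ends: "\<And>s. s \<in> {0..1} \<Longrightarrow> G1 s 0 = c" "\<And>s. s \<in> {0..1} \<Longrightarrow> reversepath (G1 s) 0 = 0"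
    "\<And>s. s \<in> {0..1} \<Longrightarrow> G2 s 0 = 0" "\<And>s. s \<in> {0..1} \<Longrightarrow> G2 s 1 = w"
    using j1 j2 by (auto simp: joins_def reversepath_def)
  have d0: "departs (Tangential c u) G1"
    and d1: "departs (Tangential 0 v) (\<lambda>s. reversepath (G1 s))"
    and d2: "departs (Tangential 0 v) G2"
    using j1 j2 by (simp_all add: joins_def)
  have "continuous_on ({0..1} \<times> {0..1}) (\<lambda>x. (\<lambda>(s, t). G1 s t) (fst x, 1 - snd x))"
    by (rule continuous_on_compose2[OF cont1]) (auto intro!: continuous_intros)
  then have cont1': "continuous_on ({0..1} \<times> {0..1}) (\<lambda>(s, t). reversepath (G1 s) t)"
    by (simp add: reversepath_def case_prod_unfold)
  obtain b1 where b1: "b1 > 0"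
    "\<And>s t. \<lbrakk>s \<in> {0..1}; 0 < t; t < b1\<rbrakk> \<Longrightarrow> dist (sgn (reversepath (G1 s) t - 0)) v < 1"
    by (rule departs_tangentialD[OF d1 zero_less_one]) blast
  obtain b2 where b2: "b2 > 0"
    "\<And>s t. \<lbrakk>s \<in> {0..1}; 0 < t; t < b2\<rbrakk> \<Longrightarrow> dist (sgn (G2 s t - 0)) v < 1"
    by (rule departs_tangentialD[OF d2 zero_less_one]) blast
  obtain b3 where b3: "b3 > 0"
    "\<And>s t. \<lbrakk>s \<in> {0..1}; t \<in> {0..b3}\<rbrakk> \<Longrightarrow> norm (reversepath (G1 s) t) < 1"
    by (rule small_near_start[where H = "\<lambda>s. reversepath (G1 s)", OF cont1' ends(2) zero_less_one]) auto
  obtain b4 where b4: "b4 > 0" "\<And>s t. \<lbrakk>s \<in> {0..1}; t \<in> {0..b4}\<rbrakk> \<Longrightarrow> norm (G2 s t) < 1"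
    by (rule small_near_start[where H = G2, OF cont2 ends(3) zero_less_one]) auto
  define b where "b = min (min b1 b2) (min (min b3 b4) (1/2))"
  have b: "b > 0" "b < 1" "b \<le> b1" "b \<le> b2" "b \<le> b3" "b \<le> b4"
    using b1(1) b2(1) b3(1) b4(1) by (auto simp: b_def)
  have segment: "linepath (G1 s (1 - e)) (G2 s e) t \<notin> {0, 1}"
    if s: "s \<in> {0..1}" and e: "0 < e" "e < b" and t: "t \<in> {0..1}" for s e t
  proof -
    let ?p = "G1 s (1 - e)" and ?q = "G2 s e"
    have "inner ?p v > 0" "inner ?q v > 0"
      using b1(2)[of s e] b2(2)[of s e] s e b v
      by (auto intro!: inner_pos_of_sgn_near simp: reversepath_def)
    then have "inner (linepath ?p ?q t) v \<noteq> 0"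
      using t unfolding linepath_def inner_add_left inner_scaleR_left
      by (metis add_pos_nonneg add_nonneg_pos atLeastAtMost_iff diff_ge_0_iff_ge less_irrefl
          mult_nonneg_nonneg mult_pos_pos order_le_less diff_gt_0_iff_gt zero_less_one)
    moreover have "?p \<in> ball 0 1" "?q \<in> ball 0 1"
      using b3(2)[of s e] b4(2)[of s e] s e b by (auto simp: reversepath_def)
    then have "closed_segment ?p ?q \<subseteq> ball 0 1"
      by (rule closed_segment_subset[OF _ _ convex_ball])
    then have "linepath ?p ?q t \<in> ball 0 1"
      using linepath_in_path[OF t, of ?p ?q] by blast
    ultimately show ?thesis by auto
  qed
  show ?thesis
  proof (rule that[OF b(1,2)])
    fix e :: "real \<Rightarrow> real"
    assume cont_e: "continuous_on {0..1} e"
      and e: "\<forall>s\<in>{0..1}. 0 < e s \<and> e s < b"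
    have e1: "0 < e s" "e s < 1" "e s < b" if "s \<in> {0..1}" for s
      using bspec[OF e that] b by auto
    let ?H = "\<lambda>s. concat_cut (e s) (G1 s) (G2 s)"
    let ?Q = "{0..1::real} \<times> {0..1::real}"
    have arg1: "(1 - e s) * (2 * t) \<in> {0..1}" if "s \<in> {0..1}" "0 \<le> t" "t \<le> 1/2" for s t
      using concat_cut_first_arg[OF e1(1,2)[OF that(1)] that(2,3)] unfolding atLeastAtMost_iff
      by (blast intro: less_imp_le)
    have arg2: "(1 - e s) * (4 * t - 3) + e s \<in> {e s..1}" if "s \<in> {0..1}" "3/4 \<le> t" "t \<le> 1" for s t
      using concat_cut_last_arg[OF e1(1,2)[OF that(1)] that(2,3)] by (simp only: atLeastAtMost_iff)
    have cont_e': "continuous_on A (\<lambda>x. e (fst x))" if "A \<subseteq> ?Q" for A :: "(real \<times> real) set"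
      by (rule continuous_on_compose2[OF cont_e continuous_on_fst[OF continuous_on_id]]) (use that in auto)
    have comp1: "continuous_on A (\<lambda>x. G1 (fst x) (f x))"
      if "continuous_on A f" "A \<subseteq> ?Q" "\<And>x. x \<in> A \<Longrightarrow> f x \<in> {0..1}" for A f
    proof -
      have "continuous_on A (\<lambda>x. (\<lambda>(s, t). G1 s t) (fst x, f x))"
        by (rule continuous_on_compose2[OF cont1]) (use that in \<open>auto intro!: continuous_intros\<close>)
      then show ?thesis by simp
    qed
    have comp2: "continuous_on A (\<lambda>x. G2 (fst x) (f x))"
      if "continuous_on A f" "A \<subseteq> ?Q" "\<And>x. x \<in> A \<Longrightarrow> f x \<in> {0..1}" for A f
    proof -
      have "continuous_on A (\<lambda>x. (\<lambda>(s, t). G2 s t) (fst x, f x))"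
        by (rule continuous_on_compose2[OF cont2]) (use that in \<open>auto intro!: continuous_intros\<close>)
      then show ?thesis by simp
    qed
    have "continuous_on ?Q (\<lambda>x. if snd x \<le> 1/2 then G1 (fst x) ((1 - e (fst x)) * (2 * snd x))
     else if snd x \<le> 3/4 then linepath (G1 (fst x) (1 - e (fst x))) (G2 (fst x) (e (fst x))) (4 * snd x - 2)
     else G2 (fst x) ((1 - e (fst x)) * (4 * snd x - 3) + e (fst x)))"
    proof (rule continuous_on_cases_le)
      show "continuous_on {x \<in> ?Q. snd x \<le> 1/2} (\<lambda>x. G1 (fst x) ((1 - e (fst x)) * (2 * snd x)))"
      proof (rule comp1)
        show "continuous_on {x \<in> ?Q. snd x \<le> 1/2} (\<lambda>x. (1 - e (fst x)) * (2 * snd x))"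
          by (intro continuous_intros cont_e') auto
        fix x assume "x \<in> {x \<in> ?Q. snd x \<le> 1/2}"
        then show "(1 - e (fst x)) * (2 * snd x) \<in> {0..1}"
          by (intro arg1) auto
      qed auto
      show "continuous_on {x \<in> ?Q. 1/2 \<le> snd x} (\<lambda>x. if snd x \<le> 3/4
          then linepath (G1 (fst x) (1 - e (fst x))) (G2 (fst x) (e (fst x))) (4 * snd x - 2)
          else G2 (fst x) ((1 - e (fst x)) * (4 * snd x - 3) + e (fst x)))"
      proof (rule continuous_on_cases_le)
        show "continuous_on {x \<in> {x \<in> ?Q. 1/2 \<le> snd x}. snd x \<le> 3/4}
            (\<lambda>x. linepath (G1 (fst x) (1 - e (fst x))) (G2 (fst x) (e (fst x))) (4 * snd x - 2))"
          unfolding linepath_def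
          by (intro continuous_intros comp1 comp2 cont_e') (use e1 in \<open>auto simp: less_imp_le\<close>)
        show "continuous_on {x \<in> {x \<in> ?Q. 1/2 \<le> snd x}. 3/4 \<le> snd x}
            (\<lambda>x. G2 (fst x) ((1 - e (fst x)) * (4 * snd x - 3) + e (fst x)))"
        proof (rule comp2)
          show "continuous_on {x \<in> {x \<in> ?Q. 1/2 \<le> snd x}. 3/4 \<le> snd x}
              (\<lambda>x. (1 - e (fst x)) * (4 * snd x - 3) + e (fst x))"
            by (intro continuous_intros cont_e') auto
          fix x assume "x \<in> {x \<in> {x \<in> ?Q. 1/2 \<le> snd x}. 3/4 \<le> snd x}"
          then have x: "fst x \<in> {0..1}" "3/4 \<le> snd x" "snd x \<le> 1" by auto
          show "(1 - e (fst x)) * (4 * snd x - 3) + e (fst x) \<in> {0..1}"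
            using arg2[OF x] e1(1)[OF x(1)] unfolding atLeastAtMost_iff
            by (blast intro: less_imp_le order.trans)
        qed auto
        fix x :: "real \<times> real" assume x: "snd x = 3/4"
        show "linepath (G1 (fst x) (1 - e (fst x))) (G2 (fst x) (e (fst x))) (4 * snd x - 2)
            = G2 (fst x) ((1 - e (fst x)) * (4 * snd x - 3) + e (fst x))"
          unfolding x linepath_def by simp
      qed (intro continuous_intros)
      fix x :: "real \<times> real" assume x: "snd x = 1/2"
      show "G1 (fst x) ((1 - e (fst x)) * (2 * snd x)) = (if snd x \<le> 3/4
          then linepath (G1 (fst x) (1 - e (fst x))) (G2 (fst x) (e (fst x))) (4 * snd x - 2)
          else G2 (fst x) ((1 - e (fst x)) * (4 * snd x - 3) + e (fst x)))"
        unfolding x linepath_def by simp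
    qed (intro continuous_intros)
    then have cont: "continuous_on ?Q (\<lambda>(s, t). ?H s t)"
      by (simp only: concat_cut_eq case_prod_unfold)
    have punct: "?H s t \<in> thrice_punctured" if s: "s \<in> {0..1}" and t: "t \<in> {0<..<1}" for s t
    proof -
      consider "t \<le> 1/2" | "1/2 < t" "t \<le> 3/4" | "3/4 < t" by linarith
      then show ?thesis
      proof cases
        case 1
        then show ?thesis
          using joins_D[OF j1 s, of "(1 - e s) * (2 * t)"] concat_cut_first_arg[OF e1(1,2)[OF s], of t] t
          by (simp add: concat_cut_eq)
      next
        case 2
        then show ?thesis
          using segment[OF s e1(1)[OF s] e1(3)[OF s], of "4 * t - 2"] by (simp add: concat_cut_eq)
      next
        case 3
        define r where "r = (1 - e s) * (4 * t - 3) + e s"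
        have "0 < r" "r < 1"
          using concat_cut_last_arg[OF e1(1,2)[OF s], of t] 3 t e1(1)[OF s] unfolding r_def by auto
        moreover have "?H s t = G2 s r"
          using 3 by (simp add: concat_cut_eq r_def)
        ultimately show ?thesis
          using joins_D[OF j2 s, of r] by simp
      qed
    qed
    have "uniform_limit {0..1} (\<lambda>t s. sgn (?H s t - c)) (\<lambda>_. u) (at_right 0)"
      unfolding uniform_limit_iff
    proof (intro allI impI)
      fix r :: real assume "r > 0"
      then obtain b' where b': "b' > 0"
        "\<And>s t. \<lbrakk>s \<in> {0..1}; 0 < t; t < b'\<rbrakk> \<Longrightarrow> dist (sgn (G1 s t - c)) u < r"
        using departs_tangentialD[OF d0] by metis
      have "dist (sgn (?H s t - c)) u < r"
        if s: "s \<in> {0..1}" and t: "0 < t" "t < min (1/2) (b' / 2)" for s t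
      proof -
        define t' where "t' = (1 - e s) * (2 * t)"
        have t': "t' \<le> 2 * t" "t' > 0"
          using concat_cut_first_arg(2,4)[OF e1(1,2)[OF s], of t, folded t'_def] t by auto
        moreover have "?H s t = G1 s t'"
          using t by (simp add: concat_cut_eq t'_def)
        ultimately show ?thesis using b'(2)[OF s, of t'] t by simp
      qed
      then show "\<forall>\<^sub>F t in at_right 0. \<forall>s\<in>{0..1}. dist (sgn (?H s t - c)) u < r"
        unfolding eventually_at_right_field using b'(1)
        by (intro exI[of _ "min (1/2) (b' / 2)"]) auto
    qed
    then have "joins (Tangential c u) (Pt w) ?H"
      using punct ends by (simp add: joins_def reversepath_def concat_cut_eq)
    with cont show "joins (Tangential c u) (Pt w) ?H \<and> continuous_on ?Q (\<lambda>(s, t). ?H s t)"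
      by blast
  qed
qed

lemma valid_path_concat_cut:
  assumes "valid_path g1" "valid_path g2" "0 \<le> e" "e \<le> 1"
  shows "valid_path (concat_cut e g1 g2)"
  unfolding concat_cut_def using assms
  by (intro valid_path_join valid_path_subpath valid_path_linepath) auto

lemma tpath_concat_cut:
  assumes g: "tpath (Tangential c u) (Tangential 0 v) g1" "tpath (Tangential 0 v) (Pt w) g2"
    and v: "norm v = 1"
  obtains b where "0 < b" "b < 1"
    "\<And>e. \<lbrakk>0 < e; e < b\<rbrakk> \<Longrightarrow> tpath (Tangential c u) (Pt w) (concat_cut e g1 g2)"
proof -
  have cont: "continuous_on ({0..1} \<times> {0..1}) (\<lambda>(s::real, t). g1 t)"
    "continuous_on ({0..1} \<times> {0..1}) (\<lambda>(s::real, t). g2 t)"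
    and j: "joins (Tangential c u) (Tangential 0 v) (\<lambda>_. g1)" "joins (Tangential 0 v) (Pt w) (\<lambda>_. g2)"
    and valid: "valid_path g1" "valid_path g2"
    using g by (auto simp: tpath_def intro!: continuous_on_const_family valid_path_imp_path)
  obtain b where b: "0 < b" "b < 1" and
    *: "\<And>e. \<lbrakk>continuous_on {0..1} e; \<forall>s\<in>{0..1}. 0 < e s \<and> e s < b\<rbrakk> \<Longrightarrow>
       joins (Tangential c u) (Pt w) (\<lambda>s. concat_cut (e s) g1 g2) \<and>
       continuous_on ({0..1} \<times> {0..1}) (\<lambda>(s, t). concat_cut (e s) g1 g2 t)"
    by (rule concat_cut_homotopy[where ?G1.0 = "\<lambda>_. g1" and ?G2.0 = "\<lambda>_. g2", OF cont j v])
      (rule that)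
  have "tpath (Tangential c u) (Pt w) (concat_cut e g1 g2)" if "0 < e" "e < b" for e
    using *[of "\<lambda>_. e"] that b valid_path_concat_cut[OF valid, of e] by (simp add: tpath_def)
  then show ?thesis using that b by blast
qed

text \<open>
  The family of concatenations in concat_cut_homotopy, with a cut that moves from e to e', is the
  homotopy. This makes the product of two classes nonempty and single-valued.
\<close>

lemma concat_cut_homotopy_rel:
  assumes h: "(g1, h1) \<in> homotopy_rel (Tangential c u) (Tangential 0 v)"
      "(g2, h2) \<in> homotopy_rel (Tangential 0 v) (Pt w)"
    and v: "norm v = 1"
  obtains b where "0 < b" "b < 1"
    "\<And>e e'. \<lbrakk>0 < e; e < b; 0 < e'; e' < b\<rbrakk> \<Longrightarrow>
       (concat_cut e g1 g2, concat_cut e' h1 h2) \<in> homotopy_rel (Tangential c u) (Pt w)"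
proof -
  obtain G1 where G1: "continuous_on ({0..1} \<times> {0..1}) (\<lambda>(s, t). G1 s t)"
    "joins (Tangential c u) (Tangential 0 v) G1"
    "\<forall>t\<in>{0..1}. G1 0 t = g1 t" "\<forall>t\<in>{0..1}. G1 1 t = h1 t"
    and t1: "tpath (Tangential c u) (Tangential 0 v) g1" "tpath (Tangential c u) (Tangential 0 v) h1"
    using h(1) unfolding homotopy_rel_def by blast
  obtain G2 where G2: "continuous_on ({0..1} \<times> {0..1}) (\<lambda>(s, t). G2 s t)"
    "joins (Tangential 0 v) (Pt w) G2"
    "\<forall>t\<in>{0..1}. G2 0 t = g2 t" "\<forall>t\<in>{0..1}. G2 1 t = h2 t"
    and t2: "tpath (Tangential 0 v) (Pt w) g2" "tpath (Tangential 0 v) (Pt w) h2"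
    using h(2) unfolding homotopy_rel_def by blast
  obtain b where b: "0 < b" "b < 1" and
    *: "\<And>e. \<lbrakk>continuous_on {0..1} e; \<forall>s\<in>{0..1}. 0 < e s \<and> e s < b\<rbrakk> \<Longrightarrow>
       joins (Tangential c u) (Pt w) (\<lambda>s. concat_cut (e s) (G1 s) (G2 s)) \<and>
       continuous_on ({0..1} \<times> {0..1}) (\<lambda>(s, t). concat_cut (e s) (G1 s) (G2 s) t)"
    by (rule concat_cut_homotopy[OF G1(1) G2(1) G1(2) G2(2) v]) (rule that)
  obtain bg where bg: "0 < bg" "bg < 1"
    "\<And>e. \<lbrakk>0 < e; e < bg\<rbrakk> \<Longrightarrow> tpath (Tangential c u) (Pt w) (concat_cut e g1 g2)"
    by (rule tpath_concat_cut[OF t1(1) t2(1) v]) (rule that)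
  obtain bh where bh: "0 < bh" "bh < 1"
    "\<And>e. \<lbrakk>0 < e; e < bh\<rbrakk> \<Longrightarrow> tpath (Tangential c u) (Pt w) (concat_cut e h1 h2)"
    by (rule tpath_concat_cut[OF t1(2) t2(2) v]) (rule that)
  have cong: "concat_cut e f1 f2 t = concat_cut e k1 k2 t"
    if eq: "\<forall>t\<in>{0..1}. f1 t = k1 t" "\<forall>t\<in>{0..1}. f2 t = k2 t" and e: "0 < e" "e < 1"
      and t: "t \<in> {0..1}" for e t and f1 f2 k1 k2 :: "real \<Rightarrow> complex"
  proof -
    have "(1 - e) * (2 * t) \<in> {0..1}" if "t \<le> 1/2"
      using concat_cut_first_arg[OF e _ that] t by auto
    moreover have "(1 - e) * (4 * t - 3) + e \<in> {0..1}" if "t > 3/4"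
      using concat_cut_last_arg[OF e, of t] that t e by auto
    ultimately show ?thesis
      using eq e by (simp add: concat_cut_eq)
  qed
  show ?thesis
  proof (rule that)
    show "0 < min b (min bg bh)" "min b (min bg bh) < 1" using b bg bh by auto
    fix e e' assume e: "0 < e" "e < min b (min bg bh)" "0 < e'" "e' < min b (min bg bh)"
    define E where "E s = linepath e e' s" for s
    have E: "continuous_on {0..1} E"
      unfolding E_def by (rule continuous_on_linepath)
    have Eb: "\<forall>s\<in>{0..1}. 0 < E s \<and> E s < b"
    proof
      fix s :: real assume s: "s \<in> {0..1}"
      have "closed_segment e e' \<subseteq> {0<..<b}"
        by (rule closed_segment_subset) (use e in auto)
      then show "0 < E s \<and> E s < b"
        using linepath_in_path[OF s, of e e'] unfolding E_def by auto
    qed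
    have "tpath (Tangential c u) (Pt w) (concat_cut e g1 g2)"
      "tpath (Tangential c u) (Pt w) (concat_cut e' h1 h2)"
      using bg(3)[of e] bh(3)[of e'] e by auto
    moreover have "\<forall>t\<in>{0..1}. concat_cut (E 0) (G1 0) (G2 0) t = concat_cut e g1 g2 t"
      "\<forall>t\<in>{0..1}. concat_cut (E 1) (G1 1) (G2 1) t = concat_cut e' h1 h2 t"
      using cong[OF G1(3) G2(3), of e] cong[OF G1(4) G2(4), of e'] e b
      by (simp_all add: E_def linepath_def)
    ultimately show "(concat_cut e g1 g2, concat_cut e' h1 h2) \<in> homotopy_rel (Tangential c u) (Pt w)"
      using *[OF E Eb] unfolding homotopy_rel_def mem_Collect_eq prod.case by blast
  qed
qed

text \<open>
  A reparametrization r is joined to the identity by a linear homotopy; positivity of r keeps the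
  intermediate paths away from the puncture 0 after the start.
\<close>

lemma polylog_path_reparametrize:
  assumes q: "valid_path q" "q 0 = 0" "\<And>t. \<lbrakk>0 < t; t \<le> 1\<rbrakk> \<Longrightarrow> q t \<in> thrice_punctured"
    and r: "continuous_on {0..1} r" "r 0 = 0" "r 1 = 1" "\<And>t. \<lbrakk>0 < t; t \<le> 1\<rbrakk> \<Longrightarrow> 0 < r t \<and> r t \<le> 1"
    and valid: "valid_path (q \<circ> r)"
  shows "polylog_path k (q \<circ> r) = polylog_path k q"
proof -
  define H where "H s t = q ((1 - s) * r t + s * t)" for s t
  have arg: "(1 - s) * r t + s * t \<in> {0<..1}" if "s \<in> {0..1}" "0 < t" "t \<le> 1" for s t
  proof -
    have "(1 - s) * r t + s * t \<in> {min (r t) t..max (r t) t}"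
      using linepath_in_path[OF that(1), of "r t" t]
      by (auto simp: linepath_def closed_segment_eq_real_ivl split: if_splits)
    then show ?thesis using r(4)[of t] that by (auto simp: min_def max_def split: if_splits)
  qed
  have arg01: "(1 - s) * r t + s * t \<in> {0..1}" if "s \<in> {0..1}" "t \<in> {0..1}" for s t
    using arg[of s t] that r(2) by (cases "t = 0") auto
  have "continuous_on {0..1} q"
    using q valid_path_imp_path by (auto simp: path_def)
  then have cont: "continuous_on ({0..1} \<times> {0..1}) (\<lambda>(s, t). H s t)"
    unfolding H_def case_prod_unfold
  proof (rule continuous_on_compose2)
    have "continuous_on ({0..1} \<times> {0..1}) (\<lambda>x::real \<times> real. r (snd x))"
      by (rule continuous_on_compose2[OF r(1) continuous_on_snd]) (auto intro: continuous_on_id)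
    then show "continuous_on ({0..1} \<times> {0..1}) (\<lambda>x. (1 - fst x) * r (snd x) + fst x * snd x)"
      by (intro continuous_intros)
  qed (use arg01 in auto)
  have start: "H s 0 = 0" and finish: "H s 1 = q 1" for s
    using q r by (auto simp: H_def)
  obtain a where a: "0 < a" "a \<le> 1" "\<And>s t. \<lbrakk>s \<in> {0..1}; t \<in> {0..a}\<rbrakk> \<Longrightarrow> norm (H s t) < 1"
    by (rule small_near_start[where H = H, OF cont start zero_less_one]) auto
  show ?thesis
  proof (rule polylog_path_homotopy_invariant[where H = H, OF cont start finish a])
    fix s t :: real assume "s \<in> {0..1}" "t \<in> {a..1}"
    then show "H s t \<notin> {0, 1}"
      using q(3)[of "(1 - s) * r t + s * t"] arg[of s t] a by (auto simp: H_def)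
  next
    fix t :: real assume "0 < t" "t \<le> 1"
    then show "(q \<circ> r) t \<noteq> 0" "q t \<noteq> 0"
      using q(3)[of "r t"] q(3)[of t] r(4)[of t] by auto
  qed (use q valid in \<open>simp_all add: H_def\<close>)
qed

text \<open>
  A first piece g inside the unit disc has no influence. In the concatenation, g and the connecting
  segment together are replaced by the piece of q up to time e, by a linear homotopy in the unit disc.
  The result is a reparametrization of q.
\<close>

lemma polylog_path_concat_cut:
  assumes g: "valid_path g" "g 0 = 0" "\<And>t. t \<in> {0..1} \<Longrightarrow> norm (g t) < 1"
    and q: "valid_path q" "q 0 = 0" "\<And>t. \<lbrakk>0 < t; t \<le> 1\<rbrakk> \<Longrightarrow> q t \<in> thrice_punctured"
    and e: "0 < e" "e < 1" "\<And>t. t \<in> {0..e} \<Longrightarrow> norm (q t) < 1"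
    and nz: "\<And>t. \<lbrakk>0 < t; t \<le> 1\<rbrakk> \<Longrightarrow> concat_cut e g q t \<noteq> 0"
  shows "polylog_path k (concat_cut e g q) = polylog_path k q"
proof -
  \<comment> \<open>The three pieces match those of the concatenation, so that both paths agree from time 3/4 on.\<close>
  define r where "r = linepath 0 (e / 2) +++ (linepath (e / 2) e +++ linepath e 1)"
  have r_eq: "r t = (if t \<le> 1/2 then e * t else if t \<le> 3/4 then e / 2 + e / 2 * (4 * t - 2)
      else (1 - e) * (4 * t - 3) + e)" for t
    by (simp add: r_def joinpaths_def linepath_def field_simps)
  have r_low: "0 \<le> r t" "r t \<le> e" "0 < t \<Longrightarrow> 0 < r t" if "0 \<le> t" "t \<le> 3/4" for t
  proof -
    consider "t \<le> 1/2" | "1/2 < t" by linarith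
    then have "0 \<le> r t \<and> r t \<le> e \<and> (0 < t \<longrightarrow> 0 < r t)"
    proof cases
      case 1
      then show ?thesis using that e mult_left_mono[of t 1 e] by (simp add: r_eq)
    next
      case 2
      then have "0 \<le> e / 2 * (4 * t - 2)" "e / 2 * (4 * t - 2) \<le> e / 2 * 1"
        using e that by (auto intro!: mult_left_mono mult_nonneg_nonneg simp del: mult_1_right)
      moreover have "r t = e / 2 + e / 2 * (4 * t - 2)"
        using 2 that by (simp add: r_eq)
      ultimately show ?thesis using e by (metis add_left_mono add_pos_nonneg field_sum_of_halves
            half_gt_zero less_imp_le mult_1_right)
    qed
    then show "0 \<le> r t" "r t \<le> e" "0 < t \<Longrightarrow> 0 < r t" by auto
  qed
  have r_high: "e \<le> r t" "r t \<le> 1" if "3/4 \<le> t" "t \<le> 1" for t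
  proof -
    have "r t = (1 - e) * (4 * t - 3) + e"
    proof (cases "t = 3/4")
      case True
      show ?thesis unfolding True r_eq by simp
    qed (use that in \<open>simp add: r_eq\<close>)
    then show "e \<le> r t" "r t \<le> 1"
      using concat_cut_last_arg(1,2)[OF e(1,2) that] by simp_all
  qed
  have r_pos: "0 < r t \<and> r t \<le> 1" if "0 < t" "t \<le> 1" for t
    using r_low(2,3)[of t] r_high[of t] that e by (cases "t \<le> 3/4") auto
  have r_cont: "continuous_on {0..1} r"
    using path_join_imp[of "linepath 0 (e / 2)" "linepath (e / 2) e +++ linepath e 1"]
    by (simp add: r_def path_join_imp flip: path_def)
  have r_ends: "r 0 = 0" "r 1 = 1"
    by (simp_all add: r_eq)
  have "q \<circ> r = subpath 0 (e / 2) q +++ (subpath (e / 2) e q +++ subpath e 1 q)"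
  proof -
    have "q \<circ> linepath u v = subpath u v q" for u v
      by (simp add: fun_eq_iff subpath_def linepath_def algebra_simps)
    then show ?thesis by (simp add: r_def path_compose_join)
  qed
  then have valid: "valid_path (q \<circ> r)"
    using q(1) e by (simp add: valid_path_join valid_path_subpath)
  have "polylog_path k (concat_cut e g q) = polylog_path k (q \<circ> r)"
  proof (rule polylog_path_homotopy_invariant
      [where H = "\<lambda>s t. linepath (concat_cut e g q t) (q (r t)) s" and a = "3/4" and z = "q 1"])
    have vc: "valid_path (concat_cut e g q)"
      using g q e by (intro valid_path_concat_cut) auto
    show "continuous_on ({0..1} \<times> {0..1}) (\<lambda>(s, t). linepath (concat_cut e g q t) (q (r t)) s)"
      using continuous_on_const_family[OF valid_path_imp_path[OF vc]]
        continuous_on_const_family[OF valid_path_imp_path[OF valid]]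
      unfolding linepath_def case_prod_unfold o_def by (intro continuous_intros)
    fix s :: real assume s: "s \<in> {0..1}"
    show "linepath (concat_cut e g q 0) (q (r 0)) s = 0"
      by (simp add: linepath_def concat_cut_eq r_ends g q)
    show "linepath (concat_cut e g q 1) (q (r 1)) s = q 1"
      by (simp add: concat_cut_eq r_ends)
    fix t :: real
    {
      assume t: "t \<in> {0..3/4}"
      have "norm (concat_cut e g q t) < 1"
      proof (cases "t \<le> 1/2")
        case True
        then show ?thesis
          using g(3)[of "(1 - e) * (2 * t)"] concat_cut_first_arg[OF e(1,2), of t] t
          by (simp add: concat_cut_eq)
      next
        case False
        have "g (1 - e) \<in> ball 0 1" "q e \<in> ball 0 1"
          using g(3)[of "1 - e"] e(3)[of e] e(1,2) by auto
        then have "closed_segment (g (1 - e)) (q e) \<subseteq> ball 0 1"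
          by (rule closed_segment_subset[OF _ _ convex_ball])
        moreover have "4 * t - 2 \<in> {0..1}" using t False by auto
        then have "linepath (g (1 - e)) (q e) (4 * t - 2) \<in> closed_segment (g (1 - e)) (q e)"
          by (rule linepath_in_path)
        ultimately show ?thesis
          using False t by (auto simp: concat_cut_eq)
      qed
      moreover have "norm (q (r t)) < 1"
        using e(3)[of "r t"] r_low[of t] t by simp
      ultimately have "closed_segment (concat_cut e g q t) (q (r t)) \<subseteq> ball 0 1"
        by (intro closed_segment_subset[OF _ _ convex_ball]) auto
      then show "norm (linepath (concat_cut e g q t) (q (r t)) s) < 1"
        using linepath_in_path[OF s, of "concat_cut e g q t" "q (r t)"] by auto
    }
    assume t: "t \<in> {3/4..1}"
    have "concat_cut e g q t = q (r t)"
    proof (cases "t = 3/4")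
      case True
      show ?thesis unfolding True concat_cut_eq r_eq by (simp add: linepath_def)
    qed (use t in \<open>simp add: concat_cut_eq r_eq\<close>)
    then show "linepath (concat_cut e g q t) (q (r t)) s \<notin> {0, 1}"
      using q(3)[of "r t"] r_high[of t] t e by auto
  next
    show "valid_path (concat_cut e g q)" "valid_path (q \<circ> r)"
      using g q e valid by (auto intro: valid_path_concat_cut)
    fix t :: real assume "0 < t" "t \<le> 1"
    then show "concat_cut e g q t \<noteq> 0" "(q \<circ> r) t \<noteq> 0"
      using nz q(3)[of "r t"] r_pos[of t] by auto
  qed (simp_all add: linepath_def)
  also have "\<dots> = polylog_path k q"
    by (rule polylog_path_reparametrize[OF q r_cont r_ends r_pos valid])
  finally show ?thesis .
qed

section \<open>Refinements of a multi-index\<close>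

fun add_to_head :: "nat list \<Rightarrow> nat list" where
  "add_to_head [] = []"
| "add_to_head (j # js) = Suc j # js"

lemma inj_add_to_head: "inj add_to_head"
proof (rule injI)
  fix xs ys assume "add_to_head xs = add_to_head ys"
  then show "xs = ys" by (cases xs; cases ys) auto
qed

text \<open>
  The reversed refinements of a reversed multi-index, by the recursion that expanding the pulled back
  forms produces: for an entry above 1 the outermost form dt/t turns into dt/(1-t), which
  splits off a new entry 1, or into dt/t, which raises the head by 1.
\<close>

fun rev_refinements :: "nat list \<Rightarrow> nat list set" where
  "rev_refinements [] = {[]}"
| "rev_refinements (0 # ks) = {}"
| "rev_refinements (Suc 0 # ks) = (#) 1 ` rev_refinements ks"
| "rev_refinements (Suc (Suc k) # ks) =
     (#) 1 ` rev_refinements (Suc k # ks) \<union> add_to_head ` rev_refinements (Suc k # ks)"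

lemma finite_rev_refinements: "finite (rev_refinements ks)"
  by (induction ks rule: rev_refinements.induct) auto

lemma rev_refinements_pos:
  "J \<in> rev_refinements ks \<Longrightarrow> \<forall>n\<in>set J. n \<ge> 1"
proof (induction ks arbitrary: J rule: rev_refinements.induct)
  case (4 k ks)
  then consider J' where "J = 1 # J'" "J' \<in> rev_refinements (Suc k # ks)"
    | J' where "J = add_to_head J'" "J' \<in> rev_refinements (Suc k # ks)"
    by auto
  then show ?case
  proof cases
    case 2
    then show ?thesis using 4(1)[of J'] by (cases J') auto
  qed (use 4(1) in auto)
qed auto

lemma rev_refinements_nonempty:
  "J \<in> rev_refinements (k # ks) \<Longrightarrow> J \<noteq> []"
proof (induction "k # ks" arbitrary: J k ks rule: rev_refinements.induct)
  case (4 k ks)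
  then consider J' where "J = 1 # J'"
    | J' where "J = add_to_head J'" "J' \<in> rev_refinements (Suc k # ks)"
    by auto
  then show ?case
  proof cases
    case 2
    then show ?thesis using 4(1)[of J'] by (cases J') auto
  qed auto
qed auto

text \<open>
  Unlike the recursive description and the one by partial sums, this description of refinements is
  symmetric under reversal. It links the other two.
\<close>

definition block_concats :: "nat list \<Rightarrow> nat list set" where
  "block_concats ks = {concat Js | Js. map sum_list Js = ks \<and> (\<forall>L\<in>set Js. L \<noteq> [] \<and> (\<forall>n\<in>set L. n \<ge> 1))}"

lemma block_concats_Nil: "block_concats [] = {[]}"
  by (auto simp: block_concats_def)

lemma block_concats_ConsI:
  assumes "sum_list L = k" "L \<noteq> []" "\<forall>n\<in>set L. n \<ge> 1" "J \<in> block_concats ks"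
  shows "L @ J \<in> block_concats (k # ks)"
proof -
  obtain Ls where "J = concat Ls" "map sum_list Ls = ks"
    "\<forall>L\<in>set Ls. L \<noteq> [] \<and> (\<forall>n\<in>set L. n \<ge> 1)"
    using assms(4) unfolding block_concats_def mem_Collect_eq by (elim exE conjE) (rule that)
  with assms(1-3) show ?thesis
    unfolding block_concats_def by (intro CollectI exI[of _ "L # Ls"]) simp
qed

lemma block_concats_ConsE:
  assumes "J \<in> block_concats (k # ks)"
  obtains L J' where "J = L @ J'" "sum_list L = k" "L \<noteq> []" "\<forall>n\<in>set L. n \<ge> 1"
    "J' \<in> block_concats ks"
proof -
  obtain Js where Js: "J = concat Js" "map sum_list Js = k # ks"
    "\<forall>L\<in>set Js. L \<noteq> [] \<and> (\<forall>n\<in>set L. n \<ge> 1)"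
    using assms unfolding block_concats_def mem_Collect_eq by (elim exE conjE) (rule that)
  obtain L Ls where Ls: "Js = L # Ls" "sum_list L = k" "map sum_list Ls = ks"
    using map_eq_Cons_D[OF Js(2)] by blast
  show thesis
  proof (rule that)
    show "J = L @ concat Ls" "sum_list L = k" "L \<noteq> []" "\<forall>n\<in>set L. n \<ge> 1"
      using Js(1,3) Ls by simp_all
    have "\<forall>L\<in>set Ls. L \<noteq> [] \<and> (\<forall>n\<in>set L. n \<ge> 1)"
      using Js(3) Ls(1) by simp
    then show "concat Ls \<in> block_concats ks"
      unfolding block_concats_def using Ls(3) by blast
  qed
qed

text \<open>
  For an entry above 1, the two sets of the recursion belong to the blocks that start with 1
  and to those that start with a larger number.
\<close>

lemma block_concats_eq_rev_refinements: "block_concats ks = rev_refinements ks"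
proof (induction ks rule: rev_refinements.induct)
  case 1
  then show ?case by (simp add: block_concats_Nil)
next
  case (2 ks)
  have "J \<notin> block_concats (0 # ks)" for J
  proof
    assume "J \<in> block_concats (0 # ks)"
    then show False
    proof (rule block_concats_ConsE)
      fix L :: "nat list" assume "sum_list L = 0" "L \<noteq> []" "\<forall>n\<in>set L. n \<ge> 1"
      then show False by (cases L) auto
    qed
  qed
  then show ?case by auto
next
  case (3 ks)
  have single: "L = [1]" if "sum_list L = Suc 0" "L \<noteq> []" "\<forall>n\<in>set L. n \<ge> 1" for L :: "nat list"
  proof -
    obtain j l where "L = j # l" using \<open>L \<noteq> []\<close> by (cases L) auto
    with that show ?thesis by (cases l) auto
  qed
  have "1 # J \<in> block_concats (Suc 0 # ks)" if "J \<in> block_concats ks" for J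
    using block_concats_ConsI[of "[1]" "Suc 0" J] that by simp
  moreover have "J \<in> (#) 1 ` block_concats ks" if J: "J \<in> block_concats (Suc 0 # ks)" for J
  proof -
    obtain L J' where "J = L @ J'" "sum_list L = Suc 0" "L \<noteq> []" "\<forall>n\<in>set L. n \<ge> 1"
      "J' \<in> block_concats ks"
      using J by (rule block_concats_ConsE)
    moreover from this have "L = [1]" by (intro single)
    ultimately show ?thesis by simp
  qed
  ultimately have "block_concats (Suc 0 # ks) = (#) 1 ` block_concats ks"
    by blast
  then show ?case using 3 by simp
next
  case (4 k ks)
  have "J \<in> (#) 1 ` block_concats (Suc k # ks) \<union> add_to_head ` block_concats (Suc k # ks)"
    if J: "J \<in> block_concats (Suc (Suc k) # ks)" for J
  proof -
    obtain L J' where J: "J = L @ J'" "sum_list L = Suc (Suc k)" "L \<noteq> []" "\<forall>n\<in>set L. n \<ge> 1"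
      "J' \<in> block_concats ks"
      using J by (rule block_concats_ConsE)
    obtain j l where L: "L = j # l" using \<open>L \<noteq> []\<close> by (cases L) auto
    show ?thesis
    proof (cases "j = 1")
      case True
      then have "l @ J' \<in> block_concats (Suc k # ks)"
        using J L by (intro block_concats_ConsI) auto
      then show ?thesis using J(1) L True by auto
    next
      case False
      with J L have "j \<ge> 2" by simp
      define i where "i = j - 2"
      with \<open>j \<ge> 2\<close> have i: "j = Suc (Suc i)" by simp
      then have "(Suc i # l) @ J' \<in> block_concats (Suc k # ks)"
        using J L by (intro block_concats_ConsI) auto
      then have "add_to_head ((Suc i # l) @ J') \<in> add_to_head ` block_concats (Suc k # ks)"
        by (rule imageI)
      then show ?thesis using J(1) L i by simp
    qed
  qed
  moreover have "1 # J \<in> block_concats (Suc (Suc k) # ks)" "add_to_head J \<in> block_concats (Suc (Suc k) # ks)"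
    if J: "J \<in> block_concats (Suc k # ks)" for J
  proof -
    obtain L J' where J: "J = L @ J'" "sum_list L = Suc k" "L \<noteq> []" "\<forall>n\<in>set L. n \<ge> 1"
      "J' \<in> block_concats ks"
      using J by (rule block_concats_ConsE)
    then show "1 # J \<in> block_concats (Suc (Suc k) # ks)"
      using block_concats_ConsI[of "1 # L" "Suc (Suc k)" J' ks] by simp
    obtain j l where "L = j # l" using \<open>L \<noteq> []\<close> by (cases L) auto
    with J show "add_to_head J \<in> block_concats (Suc (Suc k) # ks)"
      using block_concats_ConsI[of "Suc j # l" "Suc (Suc k)" J' ks] by simp
  qed
  ultimately have "block_concats (Suc (Suc k) # ks)
      = (#) 1 ` block_concats (Suc k # ks) \<union> add_to_head ` block_concats (Suc k # ks)"
    by blast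
  then show ?case using 4 by simp
qed

lemma block_concats_rev: "J \<in> block_concats ks \<Longrightarrow> rev J \<in> block_concats (rev ks)"
proof -
  assume "J \<in> block_concats ks"
  then obtain Js where Js: "J = concat Js" "map sum_list Js = ks"
    "\<forall>L\<in>set Js. L \<noteq> [] \<and> (\<forall>n\<in>set L. n \<ge> 1)"
    unfolding block_concats_def mem_Collect_eq by (elim exE conjE) (rule that)
  have "rev J = concat (rev (map rev Js))" "map sum_list (rev (map rev Js)) = rev ks"
    using Js by (simp_all add: rev_concat rev_map sum_list_rev o_def flip: Js(2))
  then show ?thesis
    using Js(3) unfolding block_concats_def by (intro CollectI exI[of _ "rev (map rev Js)"]) auto
qed

lemma sum_list_take_conv_sum_nth:
  fixes J :: "nat list"
  assumes "n \<le> length J"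
  shows "sum_list (take n J) = (\<Sum>q<n. J ! q)"
  using assms by (simp add: sum_list_sum_nth lessThan_atLeast0)

lemma refinement_Nil: "refinement J [] \<longleftrightarrow> J = []"
  by (auto simp: refinement_def)

lemma refinement_Cons:
  "refinement J (k # ks) \<longleftrightarrow>
    (\<exists>L J'. J = L @ J' \<and> sum_list L = k \<and> L \<noteq> [] \<and> refinement J' ks)"
proof
  assume "refinement J (k # ks)"
  then obtain m where m: "length m = length (k # ks)" "\<forall>n\<in>set m. n \<ge> 1" "sum_list m = length J"
    "\<forall>i<length (k # ks). (k # ks) ! i = (\<Sum>q<m ! i. J ! (sum_list (take i m) + q))"
    unfolding refinement_def by blast
  then obtain n m' where m': "m = n # m'" by (cases m) auto
  have n: "n \<ge> 1" "n \<le> length J" using m m' by auto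
  have "k = sum_list (take n J)"
    using m(4)[rule_format, of 0] m' n by (simp add: sum_list_take_conv_sum_nth)
  moreover have "refinement (drop n J) ks"
    unfolding refinement_def
  proof (intro exI[of _ m'] conjI allI impI)
    fix i assume "i < length ks"
    then have "ks ! i = (\<Sum>q<m' ! i. J ! (n + sum_list (take i m') + q))"
      using m(4)[rule_format, of "Suc i"] m' by simp
    then show "ks ! i = (\<Sum>q<m' ! i. drop n J ! (sum_list (take i m') + q))"
      using n by (simp add: add.assoc)
  qed (use m m' in auto)
  ultimately show "\<exists>L J'. J = L @ J' \<and> sum_list L = k \<and> L \<noteq> [] \<and> refinement J' ks"
    using n by (metis append_take_drop_id length_0_conv length_take min.absorb2 not_one_le_zero)
next
  assume "\<exists>L J'. J = L @ J' \<and> sum_list L = k \<and> L \<noteq> [] \<and> refinement J' ks"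
  then obtain L J' m where J: "J = L @ J'" "sum_list L = k" "L \<noteq> []"
    and m: "length m = length ks" "\<forall>n\<in>set m. n \<ge> 1" "sum_list m = length J'"
    "\<forall>i<length ks. ks ! i = (\<Sum>q<m ! i. J' ! (sum_list (take i m) + q))"
    unfolding refinement_def by blast
  \<comment> \<open>The block lengths of the whole list are the length of the new block and those of the rest.\<close>
  show "refinement J (k # ks)"
    unfolding refinement_def
  proof (intro exI[of _ "length L # m"] conjI allI impI)
    fix i assume i: "i < length (k # ks)"
    show "(k # ks) ! i = (\<Sum>q<(length L # m) ! i. J ! (sum_list (take i (length L # m)) + q))"
    proof (cases i)
      case 0
      then show ?thesis
        using J by (auto simp: nth_append sum_list_sum_nth lessThan_atLeast0)
    next
      case (Suc i')
      then show ?thesis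
        using J m(4) i by (simp add: nth_append add.assoc)
    qed
  next
    show "\<forall>n\<in>set (length L # m). 1 \<le> n"
      using J m by (cases L) auto
  qed (use J m in auto)
qed

lemma refinement_iff_block_concats:
  "(\<forall>n\<in>set J. n \<ge> 1) \<and> refinement J ks \<longleftrightarrow> J \<in> block_concats ks"
proof (induction ks arbitrary: J)
  case Nil
  then show ?case by (auto simp: refinement_Nil block_concats_Nil)
next
  case (Cons k ks)
  show ?case
  proof
    assume "(\<forall>n\<in>set J. n \<ge> 1) \<and> refinement J (k # ks)"
    then obtain L J' where "J = L @ J'" "sum_list L = k" "L \<noteq> []" "refinement J' ks"
      "\<forall>n\<in>set J. n \<ge> 1"
      unfolding refinement_Cons by blast
    then show "J \<in> block_concats (k # ks)"
      using Cons.IH[of J'] block_concats_ConsI[of L k J' ks] by simp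
  next
    assume "J \<in> block_concats (k # ks)"
    then obtain L J' where J: "J = L @ J'" "sum_list L = k" "L \<noteq> []" "\<forall>n\<in>set L. n \<ge> 1"
      "J' \<in> block_concats ks"
      by (rule block_concats_ConsE)
    then have "refinement J (k # ks)"
      using Cons.IH[of J'] unfolding refinement_Cons by blast
    moreover have "\<forall>n\<in>set J. n \<ge> 1"
      using J Cons.IH[of J'] by auto
    ultimately show "(\<forall>n\<in>set J. n \<ge> 1) \<and> refinement J (k # ks)" by blast
  qed
qed

lemma refinements_eq_rev_refinements:
  assumes "k \<noteq> []"
  shows "{J. multi_index J \<and> refinement J k} = rev ` rev_refinements (rev k)"
proof -
  have "J \<noteq> []" if "J \<in> block_concats k" for J
    using that assms by (cases k) (auto elim: block_concats_ConsE)
  then have "{J. multi_index J \<and> refinement J k} = block_concats k"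
    using refinement_iff_block_concats by (auto simp: multi_index_def)
  also have "\<dots> = rev ` block_concats (rev k)"
  proof
    show "block_concats k \<subseteq> rev ` block_concats (rev k)"
      using block_concats_rev[of _ k] by (metis image_eqI rev_rev_ident subsetI)
    show "rev ` block_concats (rev k) \<subseteq> block_concats k"
      using block_concats_rev[of _ "rev k"] by auto
  qed
  finally show ?thesis by (simp add: block_concats_eq_rev_refinements)
qed

section \<open>The half turn and the image under phi\<close>

lemma departs_tangential_const:
  "departs (Tangential a v) (\<lambda>_. g) \<longleftrightarrow> g 0 = a \<and> ((\<lambda>t. sgn (g t - a)) \<longlongrightarrow> v) (at_right 0)"
proof -
  have "uniform_limit {0..1::real} (\<lambda>t s. sgn (g t - a)) (\<lambda>_. v) (at_right 0)
      \<longleftrightarrow> ((\<lambda>t. sgn (g t - a)) \<longlongrightarrow> v) (at_right 0)"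
  proof -
    have "(\<forall>s\<in>{0..1::real}. P) \<longleftrightarrow> P" for P
      by (metis atLeastAtMost_iff order_refl zero_le_one)
    then show ?thesis by (simp only: uniform_limit_iff tendsto_iff)
  qed
  moreover have "(\<forall>s\<in>{0..1::real}. g 0 = a) \<longleftrightarrow> g 0 = a"
    by (metis atLeastAtMost_iff order_refl zero_le_one)
  ultimately show ?thesis by simp
qed

lemma tpath_01_D:
  assumes "tpath base_01 (Pt z) g" "z \<in> thrice_punctured"
  shows "valid_path g" "g 0 = 0" "g 1 = z" "\<And>t. \<lbrakk>0 < t; t \<le> 1\<rbrakk> \<Longrightarrow> g t \<in> thrice_punctured"
proof -
  show *: "valid_path g" "g 0 = 0" "g 1 = z"
    using assms(1) by (auto simp: tpath_def joins_def base_01_def reversepath_def)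
  fix t :: real assume "0 < t" "t \<le> 1"
  then show "g t \<in> thrice_punctured"
    using assms *(3) by (cases "t = 1") (auto simp: tpath_def joins_def)
qed

lemma phi_in_thrice_punctured: "w \<in> thrice_punctured \<Longrightarrow> phi w \<in> thrice_punctured"
  by (auto simp: phi_def)

text \<open>
  Near 0 the map phi is close to multiplication by -1, so it reverses the direction of departure.
\<close>

lemma tpath_phi:
  assumes g: "tpath base_01 (Pt z) g" and z: "z \<in> thrice_punctured"
  shows "tpath base_0inf (Pt (phi z)) (phi \<circ> g)"
proof -
  note g' = tpath_01_D[OF g z]
  have ne1: "g t \<noteq> 1" if "t \<in> {0..1}" for t
    using g'(2) g'(4)[of t] that by (cases "t = 0") auto
  have "phi holomorphic_on - {1}"
    unfolding phi_def[abs_def] by (intro holomorphic_intros) auto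
  then have valid: "valid_path (phi \<circ> g)"
    by (rule valid_path_compose_holomorphic[OF g'(1)]) (use ne1 in \<open>auto simp: path_image_def\<close>)
  have "(g \<longlongrightarrow> g 0) (at_right 0)"
  proof -
    have "continuous_on {0..1} g"
      using valid_path_imp_path[OF g'(1)] by (simp add: path_def)
    then have "(g \<longlongrightarrow> g 0) (at 0 within {0..1})"
      by (simp add: continuous_on_def)
    then show ?thesis by (simp add: at_within_Icc_at_right)
  qed
  then have "((\<lambda>t. sgn (1 / (g t - 1))) \<longlongrightarrow> sgn (1 / (0 - 1))) (at_right 0)"
    unfolding g'(2) by (intro tendsto_intros) auto
  moreover have "((\<lambda>t. sgn (g t - 0)) \<longlongrightarrow> 1) (at_right 0)"
    using g unfolding tpath_def joins_def base_01_def departs_tangential_const by blast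
  then have "((\<lambda>t. sgn (g t)) \<longlongrightarrow> 1) (at_right 0)" by simp
  ultimately have "((\<lambda>t. sgn (g t) * sgn (1 / (g t - 1))) \<longlongrightarrow> 1 * sgn (1 / (0 - 1))) (at_right 0)"
    by (intro tendsto_mult)
  then have "((\<lambda>t. sgn ((phi \<circ> g) t)) \<longlongrightarrow> -1) (at_right 0)"
    by (simp add: phi_def sgn_minus flip: sgn_mult)
  moreover have "phi (g t) \<in> thrice_punctured" if "t \<in> {0<..<1}" for t
    using that by (intro phi_in_thrice_punctured g'(4)) auto
  ultimately show ?thesis
    unfolding tpath_def joins_def base_0inf_def departs_tangential_const
    using valid g'(2,3) by (simp add: phi_def reversepath_def)
qed

abbreviation half_turn :: "real \<Rightarrow> complex" where
  "half_turn \<equiv> \<lambda>t. rcis (sin (pi * t) / 2) (pi * t)"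

lemma sgn_half_turn: "0 < t \<Longrightarrow> t < 1 \<Longrightarrow> sgn (half_turn t) = cis (pi * t)"
proof -
  assume "0 < t" "t < 1"
  then have "sin (pi * t) > 0" by (intro sin_gt_zero) auto
  then have "sgn (half_turn t) = of_real (sgn (sin (pi * t) / 2)) * cis (pi * t)"
    unfolding rcis_def sgn_mult sgn_of_real by (simp add: sgn_div_norm)
  then show ?thesis using \<open>sin (pi * t) > 0\<close> by simp
qed

text \<open>
  The half turn is the restriction of an entire function to the unit interval, which gives smoothness;
  its direction from 0 at time t has the argument pi t, which tends to 0 and pi at the two ends.
\<close>

lemma tpath_half_turn: "tpath base_01 base_0inf half_turn"
proof -
  have "half_turn = (\<lambda>w. sin (of_real pi * w) / 2 * exp (\<i> * (of_real pi * w))) \<circ> linepath 0 1"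
    by (rule ext) (simp add: linepath_def rcis_def cis_conv_exp sin_of_real scaleR_conv_of_real
        flip: of_real_mult)
  moreover have "valid_path \<dots>"
    by (rule valid_path_compose_holomorphic[OF valid_path_linepath, of _ UNIV])
      (auto intro!: holomorphic_intros)
  ultimately have valid: "valid_path half_turn" by simp
  have "half_turn t \<in> thrice_punctured" if t: "t \<in> {0<..<1}" for t
  proof -
    have "sin (pi * t) > 0" using t by (intro sin_gt_zero) auto
    moreover have "norm (half_turn t) = \<bar>sin (pi * t) / 2\<bar>"
      by (rule complex_mod_rcis)
    ultimately have "0 < norm (half_turn t)" "norm (half_turn t) < 1"
      using sin_le_one[of "pi * t"] by (simp, linarith)
    then show ?thesis by (metis ComplD ComplI empty_iff insert_iff less_irrefl norm_one norm_zero)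
  qed
  moreover have "((\<lambda>t. sgn (half_turn t)) \<longlongrightarrow> 1) (at_right 0)"
  proof (rule Lim_transform_eventually)
    have "((\<lambda>t::real. cis (pi * t)) \<longlongrightarrow> cis (pi * 0)) (at_right 0)"
      by (intro tendsto_intros)
    then show "((\<lambda>t::real. cis (pi * t)) \<longlongrightarrow> 1) (at_right 0)" by simp
    show "\<forall>\<^sub>F t in at_right 0. cis (pi * t) = sgn (half_turn t)"
      unfolding eventually_at_right_field using sgn_half_turn by (intro exI[of _ 1]) auto
  qed
  moreover have "((\<lambda>t. sgn (reversepath half_turn t)) \<longlongrightarrow> -1) (at_right 0)"
  proof (rule Lim_transform_eventually)
    have "((\<lambda>t::real. cis (pi * (1 - t))) \<longlongrightarrow> cis (pi * (1 - 0))) (at_right 0)"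
      by (intro tendsto_intros)
    then show "((\<lambda>t::real. cis (pi * (1 - t))) \<longlongrightarrow> -1) (at_right 0)" by simp
    show "\<forall>\<^sub>F t in at_right 0. cis (pi * (1 - t)) = sgn (reversepath half_turn t)"
      unfolding eventually_at_right_field reversepath_def using sgn_half_turn
      by (intro exI[of _ 1]) auto
  qed
  ultimately show ?thesis
    unfolding tpath_def joins_def base_01_def base_0inf_def departs_tangential_const
    using valid by (simp add: reversepath_def)
qed

section \<open>The transformation formula\<close>

text \<open>
  The pull back of dt/(1-t) under phi is -dt/(1-t), and that of dt/t is dt/t + dt/(1-t) (form1 and
  form0 below). So each entry of the multi-index contributes one sign.
\<close>

lemma polylog_rev_phi:
  assumes g: "valid_path g" "g 0 = 0" "\<And>t. \<lbrakk>0 < t; t \<le> 1\<rbrakk> \<Longrightarrow> g t \<in> thrice_punctured"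
    and t: "0 \<le> t" "t \<le> 1"
  shows "polylog_rev (phi \<circ> g) ks t = (-1) ^ length ks * (\<Sum>J\<in>rev_refinements ks. polylog_rev g J t)"
proof -
  obtain S where S: "finite S" "g C1_differentiable_on {0..1} - S"
    using g(1) by (auto simp: valid_path_def piecewise_C1_differentiable_on_def)
  define q where "q = (\<lambda>s. phi (g s))"
  let ?g' = "\<lambda>s. vector_derivative g (at s)"
  have deriv: "vector_derivative q (at s) = ?g' s * (- 1 / (g s - 1)\<^sup>2)"
    if s: "s \<in> {0..1} - insert 0 S" for s
  proof -
    have "(g has_vector_derivative ?g' s) (at s)"
      using S(2) s by (auto simp: C1_differentiable_on_eq vector_derivative_works)
    moreover have "(phi has_field_derivative - 1 / (g s - 1)\<^sup>2) (at (g s))"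
      unfolding phi_def[abs_def] using g(3)[of s] s
      by (auto intro!: derivative_eq_intros simp: power2_eq_square)
    ultimately have "(phi \<circ> g has_vector_derivative ?g' s * (- 1 / (g s - 1)\<^sup>2)) (at s)"
      by (rule field_vector_diff_chain_at)
    then show ?thesis
      unfolding q_def o_def by (rule vector_derivative_at)
  qed
  have form1: "1 / (1 - q s) * c * vector_derivative q (at s)
      = - (1 / (1 - g s) * c * ?g' s)" if s: "s \<in> {0..1} - insert 0 S" for s c
  proof -
    have ne: "g s - 1 \<noteq> 0" "1 - g s \<noteq> 0" using g(3)[of s] s by auto
    have "1 - phi (g s) = 1 / (1 - g s)"
      using ne by (simp add: phi_def divide_simps)
    moreover have "(g s - 1)\<^sup>2 = (1 - g s) * (1 - g s)"
      by (simp add: power2_commute[of "g s" 1] flip: power2_eq_square)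
    then have "(1 - g s) * (1 / (g s - 1)\<^sup>2) = 1 / (1 - g s)"
      using ne by simp
    then have "(1 - g s) * c * (?g' s * (- 1 / (g s - 1)\<^sup>2)) = - (1 / (1 - g s) * c * ?g' s)"
      by (metis (no_types, opaque_lifting) minus_divide_left mult.assoc mult.commute mult_minus_right)
    ultimately show ?thesis
      unfolding deriv[OF s] unfolding q_def by simp
  qed
  have form0: "1 / q s * c * vector_derivative q (at s)
      = 1 / (1 - g s) * c * ?g' s + 1 / g s * c * ?g' s" if s: "s \<in> {0..1} - insert 0 S" for s c
  proof -
    have ne: "g s - 1 \<noteq> 0" "1 - g s \<noteq> 0" "g s \<noteq> 0" using g(3)[of s] s by auto
    have "1 / phi (g s) * (- 1 / (g s - 1)\<^sup>2) = 1 / (1 - g s) + 1 / g s"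
      using ne by (simp add: phi_def power2_eq_square divide_simps)
    then have "(1 / phi (g s) * (- 1 / (g s - 1)\<^sup>2)) * (c * ?g' s)
        = (1 / (1 - g s) + 1 / g s) * (c * ?g' s)" by simp
    then show ?thesis
      unfolding deriv[OF s] unfolding q_def by (simp add: algebra_simps)
  qed
  have "polylog_rev q ks t = (-1) ^ length ks * (\<Sum>J\<in>rev_refinements ks. polylog_rev g J t)"
    using t
  proof (induction ks arbitrary: t rule: rev_refinements.induct)
    case 1
    then show ?case by simp
  next
    case (2 ks)
    then show ?case by simp
  next
    case (3 ks)
    let ?R = "rev_refinements ks"
    have "((\<lambda>s. (-1) ^ length (Suc 0 # ks) * (\<Sum>J\<in>?R. 1 / (1 - g s) * polylog_rev g J s * ?g' s))
        has_integral (-1) ^ length (Suc 0 # ks) * (\<Sum>J\<in>?R. polylog_rev g (Suc 0 # J) t)) {0..t}"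
      by (intro has_integral_mult_right has_integral_sum finite_rev_refinements
          polylog_rev_has_integral(1)[OF g 3(2) 3(3)])
    then have "((\<lambda>s. 1 / (1 - q s) * polylog_rev q ks s
          * vector_derivative q (at s))
        has_integral (-1) ^ length (Suc 0 # ks) * (\<Sum>J\<in>?R. polylog_rev g (Suc 0 # J) t)) {0..t}"
    proof (rule has_integral_spike_finite[rotated 2])
      show "finite (insert 0 S)" using S(1) by simp
      fix s assume s: "s \<in> {0..t} - insert 0 S"
      then have s': "s \<in> {0..1} - insert 0 S" using 3(3) by auto
      show "1 / (1 - q s) * polylog_rev q ks s * vector_derivative q (at s)
          = (-1) ^ length (Suc 0 # ks) * (\<Sum>J\<in>?R. 1 / (1 - g s) * polylog_rev g J s * ?g' s)"
      proof -
        have IH: "polylog_rev q ks s = (-1) ^ length ks * (\<Sum>J\<in>?R. polylog_rev g J s)"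
          by (rule 3(1)) (use s' in auto)
        have sign: "- (1 / (1 - g s) * ((-1) ^ length ks * X) * ?g' s)
            = (-1) ^ length (Suc 0 # ks) * (1 / (1 - g s) * X * ?g' s)" for X
          by simp
        show ?thesis
          unfolding form1[OF s'] IH sign by (simp only: sum_distrib_left sum_distrib_right)
      qed
    qed
    then have "polylog_rev q (Suc 0 # ks) t
        = (-1) ^ length (Suc 0 # ks) * (\<Sum>J\<in>?R. polylog_rev g (Suc 0 # J) t)"
      unfolding polylog_rev.simps by (rule integral_unique)
    also have "(\<Sum>J\<in>?R. polylog_rev g (Suc 0 # J) t) = (\<Sum>J\<in>rev_refinements (Suc 0 # ks). polylog_rev g J t)"
      by (simp add: sum.reindex)
    finally show ?case .
  next
    case (4 k ks)
    let ?R = "rev_refinements (Suc k # ks)" and ?e = "(-1) ^ length (Suc (Suc k) # ks) :: complex"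
    have head: "\<exists>j js. J = Suc j # js" if "J \<in> ?R" for J
      using rev_refinements_nonempty[OF that] rev_refinements_pos[OF that]
      by (metis Suc_le_D One_nat_def list.set_intros(1) neq_Nil_conv)
    have bump: "((\<lambda>s. 1 / g s * polylog_rev g J s * ?g' s) has_integral polylog_rev g (add_to_head J) t) {0..t}"
      if J: "J \<in> ?R" for J
    proof -
      obtain j js where "J = Suc j # js" using head[OF J] by blast
      then show ?thesis
        using polylog_rev_has_integral(2)[OF g 4(3) 4(4), of j js] by (simp del: polylog_rev.simps)
    qed
    have "((\<lambda>s. ?e * ((\<Sum>J\<in>?R. 1 / (1 - g s) * polylog_rev g J s * ?g' s)
            + (\<Sum>J\<in>?R. 1 / g s * polylog_rev g J s * ?g' s)))
        has_integral ?e * ((\<Sum>J\<in>?R. polylog_rev g (Suc 0 # J) t)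
            + (\<Sum>J\<in>?R. polylog_rev g (add_to_head J) t))) {0..t}"
      by (intro has_integral_mult_right has_integral_add has_integral_sum finite_rev_refinements
          polylog_rev_has_integral(1)[OF g 4(3) 4(4)] bump)
    then have "((\<lambda>s. 1 / q s * polylog_rev q (Suc k # ks) s
          * vector_derivative q (at s))
        has_integral ?e * ((\<Sum>J\<in>?R. polylog_rev g (Suc 0 # J) t)
            + (\<Sum>J\<in>?R. polylog_rev g (add_to_head J) t))) {0..t}"
    proof (rule has_integral_spike_finite[rotated 2])
      show "finite (insert 0 S)" using S(1) by simp
      fix s assume s: "s \<in> {0..t} - insert 0 S"
      then have s': "s \<in> {0..1} - insert 0 S" using 4(4) by auto
      have IH: "polylog_rev q (Suc k # ks) s = ?e * (\<Sum>J\<in>?R. polylog_rev g J s)"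
        using 4(1)[of s] s' by (simp del: polylog_rev.simps)
      show "1 / q s * polylog_rev q (Suc k # ks) s * vector_derivative q (at s)
          = ?e * ((\<Sum>J\<in>?R. 1 / (1 - g s) * polylog_rev g J s * ?g' s)
            + (\<Sum>J\<in>?R. 1 / g s * polylog_rev g J s * ?g' s))"
        unfolding form0[OF s'] IH
        by (simp only: sum_distrib_left sum_distrib_right distrib_left mult_ac)
    qed
    then have "polylog_rev q (Suc (Suc k) # ks) t
        = ?e * ((\<Sum>J\<in>?R. polylog_rev g (Suc 0 # J) t) + (\<Sum>J\<in>?R. polylog_rev g (add_to_head J) t))"
      unfolding polylog_rev.simps by (rule integral_unique)
    also have "(\<Sum>J\<in>?R. polylog_rev g (Suc 0 # J) t) + (\<Sum>J\<in>?R. polylog_rev g (add_to_head J) t)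
        = (\<Sum>J\<in>(#) 1 ` ?R. polylog_rev g J t) + (\<Sum>J\<in>add_to_head ` ?R. polylog_rev g J t)"
      using inj_add_to_head by (simp add: sum.reindex inj_on_subset[OF _ subset_UNIV])
    also have "\<dots> = (\<Sum>J\<in>rev_refinements (Suc (Suc k) # ks). polylog_rev g J t)"
    proof -
      \<comment> \<open>The lists in the first set have head 1, those in the second have a head of at least 2.\<close>
      have "(#) 1 ` ?R \<inter> add_to_head ` ?R = {}"
        using head by fastforce
      then show ?thesis
        by (simp add: sum.union_disjoint finite_rev_refinements)
    qed
    finally show ?case .
  qed
  then show ?thesis by (simp add: q_def o_def)
qed

lemma polylog_path_phi:
  assumes g: "tpath base_01 (Pt z) g" and z: "z \<in> thrice_punctured" and k: "k \<noteq> []"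
  shows "polylog_path k (phi \<circ> g)
    = (-1) ^ dp k * (\<Sum>J | multi_index J \<and> refinement J k. polylog_path J g)"
proof -
  note g' = tpath_01_D[OF g z]
  have "polylog_path k (phi \<circ> g)
      = (-1) ^ dp k * (\<Sum>J\<in>rev_refinements (rev k). polylog_rev g J 1)"
    using polylog_rev_phi[OF g'(1,2,4), of 1 "rev k"] by (simp add: polylog_path_def)
  also have "(\<Sum>J\<in>rev_refinements (rev k). polylog_rev g J 1)
      = (\<Sum>J\<in>rev ` rev_refinements (rev k). polylog_path J g)"
    by (simp add: sum.reindex polylog_path_def)
  finally show ?thesis
    unfolding refinements_eq_rev_refinements[OF k] .
qed

text \<open>
  Without a representative the definite description in polylog would be meaningless; this is why
  classes have to be shown nonempty.
\<close>

lemma polylog_eqI: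
  assumes "G \<noteq> {}" "\<And>g. g \<in> G \<Longrightarrow> polylog_path k g = v"
  shows "polylog k G = v"
  unfolding polylog_def using assms by (intro the_equality) auto

theorem theorem1p2:
  fixes z :: complex and \<gamma> \<gamma>' :: "(real \<Rightarrow> complex) set" and k :: "nat list"
  assumes "z \<in> thrice_punctured"
    and "\<gamma> \<in> pi1_top base_01 (Pt z)"
    and "\<gamma>' = pi1_mult base_01 (Pt (z / (z - 1))) delta
                (pi1_map phi base_0inf (Pt (z / (z - 1))) \<gamma>)"
    and "multi_index k"
  shows "polylog k \<gamma>' + (-1) ^ (1 + dp k) *
           (\<Sum>J | multi_index J \<and> refinement J k. polylog J \<gamma>) = 0"
proof -
  let ?hrel = "homotopy_rel base_01 (Pt z)"
    and ?hrel' = "homotopy_rel base_01 (Pt (phi z))"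
  obtain g where \<gamma>: "\<gamma> = ?hrel `` {g}" and g: "tpath base_01 (Pt z) g"
    using assms(2) unfolding pi1_top_def by (auto elim: quotientE)
  have z: "z \<in> thrice_punctured" by (fact assms(1))
  have minus1: "norm (-1 :: complex) = 1" by simp
  have polylog_\<gamma>: "polylog J \<gamma> = polylog_path J g'" if "g' \<in> \<gamma>" for J g'
  proof (rule polylog_eqI)
    have "polylog_path J h = polylog_path J g" if "h \<in> \<gamma>" for h
      using that polylog_path_homotopy_rel[OF _ z, of g h J] by (simp add: \<gamma>)
    then show "polylog_path J h = polylog_path J g'" if "h \<in> \<gamma>" for h
      using that \<open>g' \<in> \<gamma>\<close> by metis
  qed (use that in blast)
  have \<gamma>': "\<gamma>' = pi1_mult base_01 (Pt (phi z)) delta (pi1_map phi base_0inf (Pt (phi z)) \<gamma>)"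
    using assms(3) by (simp add: phi_def)
  have pz: "phi z \<in> thrice_punctured" using phi_in_thrice_punctured[OF z] .
  define v where "v = (-1) ^ dp k * (\<Sum>J | multi_index J \<and> refinement J k. polylog J \<gamma>)"
  have phi_value: "polylog_path k (phi \<circ> g') = v" if "g' \<in> \<gamma>" for g'
  proof -
    have "tpath base_01 (Pt z) g'" using that by (simp add: \<gamma> homotopy_rel_def)
    then show ?thesis
      using polylog_path_phi[of z g' k] z assms(4)
      by (simp add: v_def polylog_\<gamma>[OF that] multi_index_def)
  qed
  have concat_rel: "\<exists>b>0. \<forall>e\<in>{0<..<b}. \<forall>e'\<in>{0<..<b}.
      (concat_cut e g1 g2, concat_cut e' h1 h2) \<in> ?hrel'"
    if r: "(g1, h1) \<in> homotopy_rel base_01 base_0inf" "(g2, h2) \<in> homotopy_rel base_0inf (Pt (phi z))"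
    for g1 h1 g2 h2
  proof -
    obtain b where "0 < b" "b < 1" "\<And>e e'. \<lbrakk>0 < e; e < b; 0 < e'; e' < b\<rbrakk> \<Longrightarrow>
        (concat_cut e g1 g2, concat_cut e' h1 h2) \<in> ?hrel'"
      by (rule concat_cut_homotopy_rel[of g1 h1 0 1 "-1" g2 h2 "phi z",
            folded base_01_def base_0inf_def, OF r minus1]) (rule that)
    then show ?thesis by (intro exI[of _ b]) auto
  qed
  have polylog_delta_phi: "\<forall>\<^sub>F e in at_right 0. polylog_path k (concat_cut e half_turn (phi \<circ> g')) = v"
    if g': "g' \<in> \<gamma>" for g'
  proof -
    have tg': "tpath base_01 (Pt z) g'" using that by (simp add: \<gamma> homotopy_rel_def)
    note q = tpath_phi[OF tg' z]
    have q': "valid_path (phi \<circ> g')" "(phi \<circ> g') 0 = 0"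
      "\<And>t. \<lbrakk>0 < t; t \<le> 1\<rbrakk> \<Longrightarrow> (phi \<circ> g') t \<in> thrice_punctured"
      using q tpath_01_D[OF tg' z] phi_in_thrice_punctured
      by (simp_all add: tpath_def phi_def[of 0] del: Compl_iff)
    obtain a where a: "0 < a" "a \<le> 1" "\<And>s t. \<lbrakk>s \<in> {0..1::real}; t \<in> {0..a}\<rbrakk> \<Longrightarrow> norm ((phi \<circ> g') t) < 1"
      by (rule small_near_start[where H = "\<lambda>_. phi \<circ> g'",
            OF continuous_on_const_family[OF valid_path_imp_path[OF q'(1)]] q'(2) zero_less_one]) (rule that)
    obtain b where b: "0 < b" "b < 1"
      "\<And>e. \<lbrakk>0 < e; e < b\<rbrakk> \<Longrightarrow> tpath base_01 (Pt (phi z)) (concat_cut e half_turn (phi \<circ> g'))"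
      by (rule tpath_concat_cut[of 0 1 "-1" half_turn "phi z" "phi \<circ> g'",
            folded base_01_def base_0inf_def, OF tpath_half_turn q minus1]) (rule that)
    have "polylog_path k (concat_cut e half_turn (phi \<circ> g')) = v" if e: "0 < e" "e < min a b" for e
    proof -
      have "polylog_path k (concat_cut e half_turn (phi \<circ> g')) = polylog_path k (phi \<circ> g')"
      proof (rule polylog_path_concat_cut[OF _ _ _ q'])
        show "valid_path half_turn" using tpath_half_turn by (simp add: tpath_def)
        show "half_turn 0 = 0" by simp
        show "norm (half_turn t) < 1" for t
          using abs_sin_le_one[of "pi * t"] by (simp, linarith)
        show "norm ((phi \<circ> g') t) < 1" if "t \<in> {0..e}" for t
          using a(3)[of 0 t] that e by auto
        show "concat_cut e half_turn (phi \<circ> g') t \<noteq> 0" if "0 < t" "t \<le> 1" for t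
          using tpath_01_D(4)[OF b(3) pz, of e t] that e by auto
      qed (use e b in auto)
      then show ?thesis using phi_value[OF g'] by simp
    qed
    then show ?thesis
      unfolding eventually_at_right_field using a(1) b(1) by (intro exI[of _ "min a b"]) auto
  qed
  have "polylog k \<gamma>' = v"
  proof (rule polylog_eqI)
    have half: "half_turn \<in> delta"
      using homotopy_rel_refl[OF tpath_half_turn] by (simp add: delta_def)
    have map: "phi \<circ> g \<in> pi1_map phi base_0inf (Pt (phi z)) \<gamma>"
      using homotopy_rel_refl[OF tpath_phi[OF g z]] homotopy_rel_refl[OF g]
      by (auto simp: pi1_map_def \<gamma>)
    \<comment> \<open>Any concatenation with a sufficiently small cut, such as b/2, represents the product.\<close>
    obtain b where b: "b > 0" "\<forall>e\<in>{0<..<b}. \<forall>e'\<in>{0<..<b}.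
        (concat_cut e half_turn (phi \<circ> g), concat_cut e' half_turn (phi \<circ> g)) \<in> ?hrel'"
      using concat_rel[OF homotopy_rel_refl[OF tpath_half_turn] homotopy_rel_refl[OF tpath_phi[OF g z]]]
      by blast
    then have "\<forall>\<^sub>F e in at_right 0.
        (concat_cut e half_turn (phi \<circ> g), concat_cut (b / 2) half_turn (phi \<circ> g)) \<in> ?hrel'"
      unfolding eventually_at_right_field by (intro exI[of _ b]) simp
    then show "\<gamma>' \<noteq> {}"
      unfolding \<gamma>' pi1_mult_def using half map by blast
  next
    fix h assume "h \<in> \<gamma>'"
    then obtain g1 g2 where "g1 \<in> delta" "g2 \<in> pi1_map phi base_0inf (Pt (phi z)) \<gamma>"
      and h: "\<forall>\<^sub>F e in at_right 0. (concat_cut e g1 g2, h) \<in> ?hrel'"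
      unfolding \<gamma>' pi1_mult_def by blast
    then obtain g' where g': "g' \<in> \<gamma>" and rel: "(half_turn, g1) \<in> homotopy_rel base_01 base_0inf"
      "(phi \<circ> g', g2) \<in> homotopy_rel base_0inf (Pt (phi z))"
      unfolding delta_def pi1_map_def by blast
    obtain b where b: "b > 0" "\<forall>e\<in>{0<..<b}. \<forall>e'\<in>{0<..<b}.
        (concat_cut e half_turn (phi \<circ> g'), concat_cut e' g1 g2) \<in> ?hrel'"
      using concat_rel[OF rel] by blast
    then have "\<forall>\<^sub>F e in at_right 0. (concat_cut e half_turn (phi \<circ> g'), concat_cut e g1 g2) \<in> ?hrel'"
      unfolding eventually_at_right_field by (intro exI[of _ b]) simp
    then have "\<forall>\<^sub>F e in at_right (0::real). polylog_path k h = v"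
      using h polylog_delta_phi[OF g']
      by eventually_elim (metis polylog_path_homotopy_rel[OF _ pz])
    then show "polylog_path k h = v" by simp
  qed
  then show ?thesis by (simp add: v_def)
qed

end
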